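(* Bennett's spherical eight-bar linkage on the unit sphere $\mathcal S^2$ (defined in the context, with bars on the great circles $g_0,\dots,g_3$, $h_0,\dots,h_3$) is continuously flexible with exactly one degree of freedom. In each (non-aligned) pose, the centers of symmetry $S_1,\dots,S_6$ of the six contained spherical isograms lie on a common great circle $n$. Let $N$ be a spherical center of $n$. For each $i=1,2,3$, the rotation about $N$ which maps the oriented great circle $g_0$ to the oriented great circle $g_i$ also maps the oriented great circle $h_i$ to the oriented great circle $h_0$. Moreover, there are two mutually orthogonal great circles $t_1,t_2$ through $N$ with respect to which the intersections of $n$ with $g_0,\dots,g_3$ are respectively symmetric to the intersections of $n$ with $h_0,\dots,h_3$; that is, for every $i\in\{0,1,2,3\}$, the reflections in $t_1$ and in $t_2$ interchange the point pairs $n\cap g_i$ and $n\cap h_i$.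
   Context: Spherical geometry. $\mathcal S^2$ is the unit sphere with center $O$. Great circles play the role of lines; points on a common great circle are called aligned. Two non-antipodal points $P,Q$ determine the side $PQ$, the shorter arc of the connecting great circle, of length $\widehat{PQ}$. The spherical centers of a great circle $c$ are the two antipodal points where the diameter orthogonal to the plane of $c$ meets $\mathcal S^2$. A rotation about a point $P\in\mathcal S^2$ is a rotation about the diameter through $P$; a halfturn about $P$ is such a rotation through $180^\circ$. The reflection in a great circle is the reflection in its plane. Spherical isogram. A spherical quadrangle $P_1P_2P_3P_4$ (sides of lengths strictly between $0$ and $\pi$) whose opposite sides have equal lengths; it may be free of self-intersections or crossed. In a non-aligned pose, its centers of symmetry are the two antipodal points $S,S^\ast$ in which the two great circles carrying the diagonals $P_1P_3$ and $P_2P_4$ intersect. The halfturn about $S$ interchanges the great circles carrying opposite sides. A statement that $S$ lies on a great circle is the same for $S$ and $S^\ast$. Bennett's spherical 8-bar linkage. It has eight rigid bars, placed on great circles $g_0,g_1,g_2,g_3$ and $h_0,h_1,h_2,h_3$, and twelve revolute joints $R_{ij}$, $i,j\in\{0,1,2,3\}$, $i\neq j$. The joint $R_{ij}$ is a point of $g_i\cap h_j$; it connects the bar on $g_i$ with the bar on $h_j$, allowing relative rotation about the diameter $OR_{ij}$. Thus the bar on $g_i$ rigidly carries the three aligned points $R_{ij}$ ($j\ne i$), and the bar on $h_j$ rigidly carries the three aligned points $R_{ij}$ ($i\neq j$). The linkage is the union of six spherical isograms: whenever $\{i,j,k,l\}=\{0,1,2,3\}$, the quadrangle $R_{ik}R_{il}R_{jl}R_{jk}$,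 with sides on $g_i,h_l,g_j,h_k$, is a spherical isogram. A pose is a placement of the bars compatible with all joints, considered up to rotations of $\mathcal S^2$; non-aligned means that $g_i\ne h_j$ for all $i\neq j$ (in aligned poses all bars collapse onto one great circle, and the motion may bifurcate there). The linkage is considered in a non-aligned pose. Continuously flexible with one degree of freedom means that the bars admit a continuous one-parameter relative motion preserving all joints, and the set of poses near a non-aligned pose is one-dimensional. Centers and halfturns. $S_1,\dots,S_6$ are centers of symmetry of the isograms with sides on the following great circles, and $\sigma_1,\dots,\sigma_6$ are the halfturns about them: $S_1$: $g_0,g_3,h_1,h_2$; $S_2$: $g_0,g_1,h_2,h_3$; $S_3$: $g_0,g_2,h_1,h_3$; $S_4$: $g_1,g_2,h_3,h_0$; $S_5$: $g_2,g_3,h_1,h_0$; $S_6$: $g_1,g_3,h_2,h_0$. Orientations. An overline denotes reversal of orientation. Choose orientations of $g_0$ and $h_1$ arbitrarily and orient the remaining great circles by $\overline{g_3}=\sigma_1(g_0)$, $\overline{g_1}=\sigma_2(g_0)$, $\overline{g_2}=\sigma_3(g_0)$, $\overline{h_2}=\sigma_1(h_1)$, $\overline{h_3}=\sigma_3(h_1)$, $\overline{h_0}=\sigma_5(h_1)$.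
   Formalization: Adds the hypothesis that the eight bars can be oriented so that opposite sides of all six isograms are equal as directed arcs; with merely equal undirected lengths the centers S_1,…,S_6 need not lie on a common great circle (e.g. they can lie on three mutually orthogonal axes). *)

theory Defs
  imports "HOL-Analysis.Analysis"
begin

section \<open>Spherical geometry\<close>

text \<open>
  The sphere is the unit sphere of \<^typ>\<open>real^3\<close>. An oriented great circle is represented by the
  unit normal vector \<open>c\<close> of its plane (its pole on the left-hand side); reversing the orientation
  is \<open>c \<mapsto> - c\<close>, and a rotation \<open>\<rho>\<close> maps the oriented circle \<open>c\<close> to the oriented circle \<open>\<rho> c\<close>.
  Unoriented great circles are point sets.
\<close>

definition great_circle :: "real^3 \<Rightarrow> (real^3) set" where
  "great_circle c = {x. norm x = 1 \<and> c \<bullet> x = 0}"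

definition is_great_circle :: "(real^3) set \<Rightarrow> bool" where
  "is_great_circle n \<longleftrightarrow> (\<exists>c. norm c = 1 \<and> n = great_circle c)"

definition spherical_center :: "real^3 \<Rightarrow> (real^3) set \<Rightarrow> bool" where
  "spherical_center N n \<longleftrightarrow> norm N = 1 \<and> n = great_circle N"

definition sdist :: "real^3 \<Rightarrow> real^3 \<Rightarrow> real" where
  "sdist x y = arccos (x \<bullet> y)"

definition rotation_about :: "real^3 \<Rightarrow> (real^3 \<Rightarrow> real^3) \<Rightarrow> bool" where
  "rotation_about P \<rho> \<longleftrightarrow> orthogonal_transformation \<rho> \<and> det (matrix \<rho>) = 1 \<and> \<rho> P = P"

text \<open>The rotation through 180 degrees about the diameter through the unit vector \<open>S\<close>.\<close>

definition halfturn :: "real^3 \<Rightarrow> real^3 \<Rightarrow> real^3" where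
  "halfturn S x = (2 * (S \<bullet> x)) *\<^sub>R S - x"

text \<open>The reflection in the plane of \<^term>\<open>great_circle c\<close>, for a unit vector \<open>c\<close>.\<close>

definition gc_reflection :: "real^3 \<Rightarrow> real^3 \<Rightarrow> real^3" where
  "gc_reflection c x = x - (2 * (c \<bullet> x)) *\<^sub>R c"

lemma halfturn_rotation:
  assumes "norm S = 1"
  shows "rotation_about S (halfturn S)" "halfturn S (halfturn S x) = x"
    "S \<bullet> x = 0 \<Longrightarrow> halfturn S x = - x"
proof -
  have S: "S \<bullet> S = 1"
    using assms by (simp add: norm_eq_1)
  have lin: "linear (halfturn S)"
    by (rule linearI) (simp_all add: halfturn_def algebra_simps inner_add_right)
  have orth: "orthogonal_transformation (halfturn S)"
    using lin S unfolding orthogonal_transformation_def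
    by (simp add: halfturn_def inner_diff_left inner_diff_right inner_commute)
  have s: "S$1 * S$1 + S$2 * S$2 + S$3 * S$3 = 1"
    using S by (simp add: inner_vec_def sum_3)
  have "det (matrix (halfturn S)) = 2 * (S$1 * S$1 + S$2 * S$2 + S$3 * S$3) - 1"
    by (simp add: det_3 matrix_def halfturn_def inner_vec_def sum_3 axis_def algebra_simps)
  then show "rotation_about S (halfturn S)"
    using orth S s unfolding rotation_about_def by (simp add: halfturn_def scaleR_2)
  show "halfturn S (halfturn S x) = x"
    using S by (simp add: halfturn_def inner_diff_right)
  show "S \<bullet> x = 0 \<Longrightarrow> halfturn S x = - x"
    by (simp add: halfturn_def)
qed

definition spherical_isogram ::
    "real^3 \<Rightarrow> real^3 \<Rightarrow> real^3 \<Rightarrow> real^3 \<Rightarrow> bool" where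
  "spherical_isogram P1 P2 P3 P4 \<longleftrightarrow>
     norm P1 = 1 \<and> norm P2 = 1 \<and> norm P3 = 1 \<and> norm P4 = 1 \<and>
     sdist P1 P2 \<in> {0<..<pi} \<and> sdist P2 P3 \<in> {0<..<pi} \<and>
     sdist P3 P4 \<in> {0<..<pi} \<and> sdist P4 P1 \<in> {0<..<pi} \<and>
     sdist P1 P2 = sdist P3 P4 \<and> sdist P2 P3 = sdist P4 P1"

definition symmetry_center ::
    "real^3 \<Rightarrow> real^3 \<Rightarrow> real^3 \<Rightarrow> real^3 \<Rightarrow> real^3 \<Rightarrow> bool" where
  "symmetry_center P1 P2 P3 P4 S \<longleftrightarrow>
     (\<exists>d e. is_great_circle d \<and> is_great_circle e \<and> d \<noteq> e \<and>
        P1 \<in> d \<and> P3 \<in> d \<and> P2 \<in> e \<and> P4 \<in> e \<and> S \<in> d \<inter> e)"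


section \<open>The eight-bar linkage\<close>

text \<open>
  The indices 0, 1, 2, 3 are the elements of the four-element type \<^typ>\<open>4\<close>.
  Of a family \<open>J\<close> only the twelve values \<open>J i j\<close> with \<open>i \<noteq> j\<close> are meaningful.
  The families \<open>G\<close>, \<open>H\<close>, \<open>J\<close> describe the eight bars and twelve joints of the linkage in some
  reference placement, which may be aligned.
\<close>

definition bennett_linkage ::
    "(4 \<Rightarrow> (real^3) set) \<Rightarrow> (4 \<Rightarrow> (real^3) set) \<Rightarrow> (4 \<Rightarrow> 4 \<Rightarrow> real^3) \<Rightarrow> bool" where
  "bennett_linkage G H J \<longleftrightarrow>
     (\<forall>i. is_great_circle (G i) \<and> is_great_circle (H i)) \<and>
     (\<forall>i j. i \<noteq> j \<longrightarrow> J i j \<in> G i \<inter> H j) \<and>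
     (\<forall>i j k l. {i, j, k, l} = {0, 1, 2, 3} \<longrightarrow>
        spherical_isogram (J i k) (J i l) (J j l) (J j k))"

text \<open>
  The eight bars can be oriented so that opposite sides of each of the six isograms agree as
  directed arcs, i.e. the arc from \<open>J i k\<close> to \<open>J i l\<close> on bar \<open>G i\<close> has the same sign as the arc from
  \<open>J j k\<close> to \<open>J j l\<close> on bar \<open>G j\<close>, and likewise for the bars \<open>H l\<close> and \<open>H k\<close>.
  Here \<open>c \<bullet> cross3 x y\<close> is the sine of the directed arc from \<open>x\<close> to \<open>y\<close> on the great circle
  oriented by \<open>c\<close>; since the undirected lengths agree, only its sign carries information.
  This depends on the bars only, not on how they are placed.

  The condition cannot be dropped. If \<open>c\<^sub>0\<close>, \<open>d\<^sub>0\<close> are generic unit vectors and \<open>\<delta>\<^sub>0, \<dots>, \<delta>\<^sub>3\<close> are the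
  identity and the halfturns about three mutually orthogonal axes, then the great circles with normals
  \<open>\<delta>\<^sub>i c\<^sub>0\<close> and \<open>\<delta>\<^sub>j d\<^sub>0\<close> form six isograms whose centers of symmetry are the points on these three axes.
\<close>

definition coherently_directed ::
    "(4 \<Rightarrow> (real^3) set) \<Rightarrow> (4 \<Rightarrow> (real^3) set) \<Rightarrow> (4 \<Rightarrow> 4 \<Rightarrow> real^3) \<Rightarrow> bool" where
  "coherently_directed G H J \<longleftrightarrow>
     (\<exists>a b. (\<forall>i. norm (a i) = 1 \<and> G i = great_circle (a i) \<and>
                 norm (b i) = 1 \<and> H i = great_circle (b i)) \<and>
        (\<forall>i j k l. {i, j, k, l} = {0, 1, 2, 3} \<longrightarrow>
           a i \<bullet> cross3 (J i k) (J i l) = a j \<bullet> cross3 (J j k) (J j l) \<and>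
           b l \<bullet> cross3 (J i l) (J j l) = b k \<bullet> cross3 (J i k) (J j k)))"

text \<open>
  A pose \<open>(u, v)\<close> displaces the bar \<open>G i\<close> by the rotation \<open>u $ i\<close> and the bar \<open>H j\<close> by the rotation
  \<open>v $ j\<close>, in such a way that the two copies of each joint \<open>J i j\<close> stay together.
\<close>

type_synonym pose = "(real^3^3^4) \<times> (real^3^3^4)"

definition poses :: "(4 \<Rightarrow> 4 \<Rightarrow> real^3) \<Rightarrow> pose set" where
  "poses J = {(u, v). (\<forall>i. rotation_matrix (u $ i) \<and> rotation_matrix (v $ i)) \<and>
                      (\<forall>i j. i \<noteq> j \<longrightarrow> u $ i *v J i j = v $ j *v J i j)}"

definition rotate_pose :: "real^3^3 \<Rightarrow> pose \<Rightarrow> pose" where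
  "rotate_pose M P = (\<chi> i. M ** (fst P $ i), \<chi> i. M ** (snd P $ i))"

text \<open>
  Poses are considered up to a common rotation of all bars, i.e. up to \<^const>\<open>rotate_pose\<close>. Each class
  is represented by its unique member in which the bar \<open>G 0\<close> is placed as in a given pose \<open>P\<close>.
\<close>

definition relative_poses :: "(4 \<Rightarrow> 4 \<Rightarrow> real^3) \<Rightarrow> pose \<Rightarrow> pose set" where
  "relative_poses J P = {Q \<in> poses J. fst Q $ 0 = fst P $ 0}"

lemma relative_poses_unique:
  assumes P: "P \<in> poses J" and Q: "Q \<in> poses J"
  shows "\<exists>!M. rotation_matrix M \<and> rotate_pose M Q \<in> relative_poses J P"
proof -
  let ?p = "fst P $ 0" and ?q = "fst Q $ 0"
  have p: "rotation_matrix ?p" and q: "rotation_matrix ?q"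
    using P Q by (auto simp: poses_def)
  have qq: "transpose ?q ** ?q = mat 1" "?q ** transpose ?q = mat 1"
    using q by (simp_all add: rotation_matrix_def orthogonal_matrix_def)
  have mem: "rotate_pose M Q \<in> relative_poses J P \<longleftrightarrow> M ** ?q = ?p" if M: "rotation_matrix M" for M
    using Q M by (auto simp: rotate_pose_def relative_poses_def poses_def rotation_matrix_def
        orthogonal_matrix_mul det_mul matrix_vector_mul_assoc[symmetric])
  show ?thesis
  proof (rule ex1I[of _ "?p ** transpose ?q"])
    have "rotation_matrix (?p ** transpose ?q)"
      using p q by (simp add: rotation_matrix_def orthogonal_matrix_mul det_mul orthogonal_matrix_transpose)
    then show "rotation_matrix (?p ** transpose ?q) \<and>
        rotate_pose (?p ** transpose ?q) Q \<in> relative_poses J P"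
      using mem qq by (simp add: matrix_mul_assoc[symmetric])
  next
    fix M assume "rotation_matrix M \<and> rotate_pose M Q \<in> relative_poses J P"
    then have "M ** ?q = ?p" using mem by blast
    then have "M ** ?q ** transpose ?q = ?p ** transpose ?q" by simp
    then show "M = ?p ** transpose ?q" using qq by (simp add: matrix_mul_assoc[symmetric])
  qed
qed

text \<open>
  Near the pose \<open>P\<close>, the relative poses are exactly those passed through by a one-parameter continuous
  motion \<open>\<phi>\<close> through \<open>P\<close>, which parametrizes them homeomorphically by an open interval.
\<close>

definition flexible_with_one_dof :: "(4 \<Rightarrow> 4 \<Rightarrow> real^3) \<Rightarrow> pose \<Rightarrow> bool" where
  "flexible_with_one_dof J P \<longleftrightarrow>
     (\<exists>U \<phi> \<psi>. open U \<and> P \<in> U \<and>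
        homeomorphism {-1<..<1::real} (U \<inter> relative_poses J P) \<phi> \<psi> \<and> \<phi> 0 = P)"

definition non_aligned :: "(4 \<Rightarrow> (real^3) set) \<Rightarrow> (4 \<Rightarrow> (real^3) set) \<Rightarrow> bool" where
  "non_aligned g h \<longleftrightarrow> (\<forall>i j. i \<noteq> j \<longrightarrow> g i \<noteq> h j)"

definition symmetry_centers :: "(4 \<Rightarrow> 4 \<Rightarrow> real^3) \<Rightarrow> (nat \<Rightarrow> real^3) \<Rightarrow> bool" where
  "symmetry_centers R S \<longleftrightarrow>
     symmetry_center (R 0 1) (R 0 2) (R 3 2) (R 3 1) (S 1) \<and>
     symmetry_center (R 0 2) (R 0 3) (R 1 3) (R 1 2) (S 2) \<and>
     symmetry_center (R 0 1) (R 0 3) (R 2 3) (R 2 1) (S 3) \<and>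
     symmetry_center (R 1 3) (R 1 0) (R 2 0) (R 2 3) (S 4) \<and>
     symmetry_center (R 2 1) (R 2 0) (R 3 0) (R 3 1) (S 5) \<and>
     symmetry_center (R 1 2) (R 1 0) (R 3 0) (R 3 2) (S 6)"

definition standard_orientation ::
    "(4 \<Rightarrow> (real^3) set) \<Rightarrow> (4 \<Rightarrow> (real^3) set) \<Rightarrow> (nat \<Rightarrow> real^3) \<Rightarrow>
     (4 \<Rightarrow> real^3) \<Rightarrow> (4 \<Rightarrow> real^3) \<Rightarrow> bool" where
  "standard_orientation g h S \<gamma> \<eta> \<longleftrightarrow>
     (\<forall>i. norm (\<gamma> i) = 1 \<and> g i = great_circle (\<gamma> i) \<and>
          norm (\<eta> i) = 1 \<and> h i = great_circle (\<eta> i)) \<and>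
     - \<gamma> 3 = halfturn (S 1) (\<gamma> 0) \<and>
     - \<gamma> 1 = halfturn (S 2) (\<gamma> 0) \<and>
     - \<gamma> 2 = halfturn (S 3) (\<gamma> 0) \<and>
     - \<eta> 2 = halfturn (S 1) (\<eta> 1) \<and>
     - \<eta> 3 = halfturn (S 3) (\<eta> 1) \<and>
     - \<eta> 0 = halfturn (S 5) (\<eta> 1)"

end

theory Submission
  imports Defs
begin

text \<open>
  Flexibility. Since opposite sides agree as directed arcs, all bars can be laid on the equator, the joint
  \<open>R\<^sub>i\<^sub>k\<close> at \<open>r\<^sub>i\<^sub>k = T\<^sub>i S\<^sub>k\<close> (unit complex numbers). In a non-aligned pose the bar on \<open>h\<^sub>k\<close> arises from that on
  \<open>g\<^sub>i\<close> by a turn about \<open>r\<^sub>i\<^sub>k\<close> with half-angle tangent \<open>t\<^sub>i\<^sub>k\<close>, i.e. by the quaternion \<open>1 + t\<^sub>i\<^sub>k r\<^sub>i\<^sub>k\<close>, and an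
  isogram closes iff \<open>t\<^sub>i\<^sub>k t\<^sub>j\<^sub>k = t\<^sub>i\<^sub>l t\<^sub>j\<^sub>l\<close> and \<open>t\<^sub>i\<^sub>k r\<^sub>i\<^sub>k - t\<^sub>j\<^sub>k r\<^sub>j\<^sub>k = t\<^sub>i\<^sub>l r\<^sub>i\<^sub>l - t\<^sub>j\<^sub>l r\<^sub>j\<^sub>l\<close>. These equations are
  homogeneous, so multiplying all \<open>t\<^sub>i\<^sub>k\<close> by a common positive factor is a motion; and two solutions with
  the same signs are proportional, so there is no other motion.

  Geometry of a pose. Let \<open>a\<^sub>i\<close>, \<open>b\<^sub>k\<close> be the poles of the directed bars. The halfturn about the center of the
  isogram on \<open>g\<^sub>i, g\<^sub>j, h\<^sub>k, h\<^sub>l\<close> maps \<open>a\<^sub>i\<close> to \<open>- a\<^sub>j\<close> and \<open>b\<^sub>k\<close> to \<open>- b\<^sub>l\<close>, so \<open>a\<^sub>i - a\<^sub>j\<close> and \<open>b\<^sub>k - b\<^sub>l\<close> are parallel to this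
  center. As \<open>b\<^sub>1 - b\<^sub>2\<close>, \<open>b\<^sub>2 - b\<^sub>3\<close>, \<open>b\<^sub>1 - b\<^sub>3\<close> are linearly dependent, so are \<open>S\<^sub>1\<close>, \<open>S\<^sub>2\<close>, \<open>S\<^sub>3\<close>; hence all centers lie in one
  plane. In a complex coordinate of this plane the components \<open>\<xi>\<^sub>i\<close> of \<open>a\<^sub>i\<close> and \<open>\<upsilon>\<^sub>i\<close> of \<open>b\<^sub>i\<close> have constant product
  \<open>\<xi>\<^sub>i \<upsilon>\<^sub>i\<close>, which yields the claims on rotations and reflections.
\<close>

section \<open>Great circles and isograms\<close>

lemma cross3_self_eq:
  fixes c x y :: "real^3"
  assumes "norm c = 1" "c \<bullet> x = 0" "c \<bullet> y = 0"
  shows "cross3 x y = (c \<bullet> cross3 x y) *\<^sub>R c"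
proof -
  have "cross3 c (cross3 x y) = 0"
    using assms by (simp add: Lagrange)
  then have "cross3 c (cross3 c (cross3 x y)) = 0"
    by simp
  then show ?thesis
    using assms(1) Lagrange[of c c "cross3 x y"] by (simp add: norm_eq_1)
qed

text \<open>The common orthogonal complement of two independent vectors is the line spanned by their
  cross product. Read backwards: two different great circles cannot share two independent
  points.\<close>

lemma cross3_self_eq_0_of_orthogonal:
  fixes c d x y :: "real^3"
  assumes "cross3 c d \<noteq> 0" "c \<bullet> x = 0" "d \<bullet> x = 0" "c \<bullet> y = 0" "d \<bullet> y = 0"
  shows "cross3 x y = 0"
proof -
  have eq: "cross3 (cross3 c d) z = 0" if "c \<bullet> z = 0" "d \<bullet> z = 0" for z
  proof -
    have "cross3 z (cross3 c d) = 0"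
      using that by (simp add: Lagrange inner_commute)
    then show ?thesis
      by (simp add: cross_skew[of "cross3 c d" z])
  qed
  let ?w = "cross3 c d"
  have par: "(?w \<bullet> ?w) *\<^sub>R z = (?w \<bullet> z) *\<^sub>R ?w" if "cross3 ?w z = 0" for z
    using that Lagrange[of ?w ?w z] by simp
  have "cross3 ((?w \<bullet> ?w) *\<^sub>R x) ((?w \<bullet> ?w) *\<^sub>R y) = 0"
    using par[OF eq[of x]] par[OF eq[of y]] assms by (simp add: cross_mult_left cross_mult_right)
  then show ?thesis
    using assms(1) by (simp add: cross_mult_left cross_mult_right)
qed

lemma cross3_eq_0_scaleR:
  fixes x y :: "real^3"
  assumes "cross3 x y = 0" "norm y = 1"
  shows "x = (y \<bullet> x) *\<^sub>R y"
proof -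
  have "cross3 y (cross3 y x) = 0"
    using assms cross_skew[of y x] by simp
  then show ?thesis
    using assms by (simp add: Lagrange norm_eq_1)
qed

lemma unit_cross3_eq_0:
  fixes x y :: "real^3"
  assumes "norm x = 1" "norm y = 1"
  shows "cross3 x y = 0 \<longleftrightarrow> x = y \<or> x = - y"
proof
  assume "cross3 x y = 0"
  then have x: "x = (y \<bullet> x) *\<^sub>R y"
    using assms cross3_eq_0_scaleR by blast
  then have "\<bar>y \<bullet> x\<bar> = 1"
    using assms by (metis norm_scaleR mult.right_neutral)
  then have "y \<bullet> x = 1 \<or> y \<bullet> x = - 1" by linarith
  then show "x = y \<or> x = - y" using x by auto
qed auto

text \<open>A nonzero component of \<open>b\<close> orthogonal to \<open>a\<close>, once normalized,
  is a point of the first circle; lying on the second one as well makes it orthogonal to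
  \<open>b\<close> and so to itself.\<close>

lemma great_circle_eq_iff:
  assumes "norm a = 1" "norm b = 1"
  shows "great_circle a = great_circle b \<longleftrightarrow> a = b \<or> a = - b"
proof
  assume eq: "great_circle a = great_circle b"
  let ?x = "b - (a \<bullet> b) *\<^sub>R a"
  have a: "a \<bullet> a = 1" and b: "b \<bullet> b = 1" using assms by (simp_all add: norm_eq_1)
  show "a = b \<or> a = - b"
  proof (cases "?x = 0")
    case True
    then have "cross3 b a = 0"
      by (metis cross_mult_left cross_refl eq_iff_diff_eq_0 scaleR_zero_right)
    then show ?thesis using unit_cross3_eq_0[of b a] assms by auto
  next
    case False
    have "a \<bullet> ?x = 0" using a by (simp add: inner_diff_right)
    then have "?x /\<^sub>R norm ?x \<in> great_circle a"
      using False by (simp add: great_circle_def)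
    then have "b \<bullet> (?x /\<^sub>R norm ?x) = 0"
      unfolding eq by (simp add: great_circle_def)
    then have "b \<bullet> ?x = 0"
      unfolding inner_scaleR_right using False by (metis inverse_zero_imp_zero mult_eq_0_iff norm_eq_zero)
    then have "?x \<bullet> ?x = 0"
      using \<open>a \<bullet> ?x = 0\<close> by (simp add: inner_diff_left)
    then show ?thesis using False by simp
  qed
qed (auto simp: great_circle_def)

lemma rotation_matrix_inner:
  fixes A :: "real^'n^'n"
  assumes "rotation_matrix A"
  shows "(A *v x) \<bullet> (A *v y) = x \<bullet> y"
proof -
  have "orthogonal_transformation ((*v) A)"
    using assms by (simp add: orthogonal_transformation_matrix rotation_matrix_def matrix_of_matrix_vector_mul)
  then show ?thesis by (simp add: orthogonal_transformation_def)
qed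

lemma rotation_matrix_norm:
  fixes A :: "real^'n^'n"
  assumes "rotation_matrix A"
  shows "norm (A *v x) = norm x"
  using rotation_matrix_inner[OF assms, of x x] by (simp add: norm_eq_sqrt_inner)

lemma rotation_about_cross3:
  assumes "rotation_about P \<rho>"
  shows "cross3 (\<rho> x) (\<rho> y) = \<rho> (cross3 x y)"
  using assms cross_orthogonal_transformation[of \<rho> x y] by (simp add: rotation_about_def)

lemma rotation_matrix_great_circle:
  assumes "rotation_matrix u"
  shows "(\<lambda>x. u *v x) ` great_circle c = great_circle (u *v c)"
proof -
  have o: "u ** transpose u = mat 1"
    using assms by (simp add: rotation_matrix_def orthogonal_matrix_def)
  have "y \<in> (\<lambda>x. u *v x) ` great_circle c" if "y \<in> great_circle (u *v c)" for y
  proof -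
    have y: "y = u *v (transpose u *v y)"
      by (metis matrix_vector_mul_assoc matrix_vector_mul_lid o)
    have "norm (transpose u *v y) = 1" "c \<bullet> (transpose u *v y) = 0"
      using that rotation_matrix_norm[OF assms, of "transpose u *v y"]
        rotation_matrix_inner[OF assms, of c "transpose u *v y"] y
      by (auto simp: great_circle_def)
    then show ?thesis using y by (auto simp: great_circle_def)
  qed
  then show ?thesis
    by (auto simp: great_circle_def rotation_matrix_norm[OF assms] rotation_matrix_inner[OF assms])
qed

section \<open>Halfturns and the symmetry of an isogram\<close>

lemma halfturn_diff:
  assumes "halfturn S x = - y"
  shows "x - y = (2 * (S \<bullet> x)) *\<^sub>R S"
  using assms by (simp add: halfturn_def algebra_simps)

lemma halfturn_uminus_swap:
  assumes "norm S = 1" "halfturn S x = - y"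
  shows "halfturn S y = - x"
proof -
  have "x = halfturn S (- y)"
    using halfturn_rotation(2)[OF assms(1), of x] assms(2) by simp
  then show ?thesis by (simp add: halfturn_def)
qed

text \<open>Because opposite sides are equal, the halfturn about \<open>S\<close> exchanges opposite
  vertices, possibly up to a common antipodal sign. Poles are multiples of cross products of two
  vertices, where that sign cancels; the directed arcs in \<open>dir\<close> decide the sign of the
  image pole.\<close>

lemma isogram_halfturn:
  fixes P1 P2 P3 P4 c c' d d' :: "real^3"
  assumes unit: "norm P1 = 1" "norm P2 = 1" "norm P3 = 1" "norm P4 = 1"
      "norm c = 1" "norm c' = 1" "norm d = 1" "norm d' = 1"
    and orth: "c \<bullet> P1 = 0" "c \<bullet> P2 = 0" "c' \<bullet> P3 = 0" "c' \<bullet> P4 = 0"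
      "d \<bullet> P2 = 0" "d \<bullet> P3 = 0" "d' \<bullet> P1 = 0" "d' \<bullet> P4 = 0"
    and len: "P1 \<bullet> P2 = P3 \<bullet> P4" "P2 \<bullet> P3 = P4 \<bullet> P1"
    and dir: "c \<bullet> cross3 P1 P2 = c' \<bullet> cross3 P4 P3" "d \<bullet> cross3 P2 P3 = d' \<bullet> cross3 P1 P4"
    and nz: "cross3 P1 P2 \<noteq> 0" "cross3 P2 P3 \<noteq> 0"
    and na: "cross3 c d \<noteq> 0" "cross3 c d' \<noteq> 0"
    and center: "symmetry_center P1 P2 P3 P4 S"
  shows "norm S = 1" "halfturn S c = - c'" "halfturn S d = - d'"
proof -
  have u: "P1 \<bullet> P1 = 1" "P2 \<bullet> P2 = 1" "P3 \<bullet> P3 = 1" "P4 \<bullet> P4 = 1"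
    using unit by (simp_all add: norm_eq_1)
  obtain m m' where m: "norm m = 1" "norm m' = 1" "great_circle m \<noteq> great_circle m'"
      "m \<bullet> P1 = 0" "m \<bullet> P3 = 0" "m' \<bullet> P2 = 0" "m' \<bullet> P4 = 0" "m \<bullet> S = 0" "m' \<bullet> S = 0"
      and S: "norm S = 1"
    using center unfolding symmetry_center_def is_great_circle_def great_circle_def by auto
  show "norm S = 1" by (fact S)
  have mm: "cross3 m m' \<noteq> 0"
    using m great_circle_eq_iff unit_cross3_eq_0 by blast
  \<comment> \<open>Were \<open>P1\<close> and \<open>P3\<close> equal or antipodal, both
    \<open>P1\<close> and \<open>P2\<close> would be orthogonal to the independent normals
    \<open>c\<close> and \<open>d\<close>, and their side would degenerate.\<close>
  have ne: "P1 + P3 \<noteq> 0" "P1 - P3 \<noteq> 0"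
    using cross3_self_eq_0_of_orthogonal[OF na(1), of P1 P2] orth nz
    by (auto simp: eq_neg_iff_add_eq_0[symmetric])
  have ne': "P2 + P4 \<noteq> 0" "P2 - P4 \<noteq> 0"
    using cross3_self_eq_0_of_orthogonal[OF na(2), of P1 P2] orth nz
    by (auto simp: eq_neg_iff_add_eq_0[symmetric])
  \<comment> \<open>The diagonal sums are orthogonal to the diagonal differences, so in three
    dimensions the two sums are parallel or the two differences are.\<close>
  have perp: "(P1 + P3) \<bullet> (P1 - P3) = 0" "(P1 + P3) \<bullet> (P2 - P4) = 0"
      "(P2 + P4) \<bullet> (P1 - P3) = 0" "(P2 + P4) \<bullet> (P2 - P4) = 0"
    using u len by (simp_all add: inner_add_left inner_add_right inner_diff_left inner_diff_right inner_commute)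
  \<comment> \<open>Parallel vectors, one in the plane of each diagonal, lie in the intersection of
    these planes, which is the axis through \<open>S\<close>.\<close>
  have par: "X = (S \<bullet> X) *\<^sub>R S \<and> Y = (S \<bullet> Y) *\<^sub>R S"
    if XY: "cross3 X Y = 0" "X \<noteq> 0" "Y \<noteq> 0" "m \<bullet> X = 0" "m' \<bullet> Y = 0" for X Y
  proof -
    have ex: "\<exists>k. A = k *\<^sub>R B" if "cross3 A B = 0" "B \<noteq> 0" for A B :: "real^3"
    proof -
      have "cross3 A (B /\<^sub>R norm B) = 0" "norm (B /\<^sub>R norm B) = 1"
        using that by (simp_all add: cross_mult_right)
      from cross3_eq_0_scaleR[OF this] show ?thesis by (metis scaleR_scaleR)
    qed
    obtain k where "X = k *\<^sub>R Y" using ex[of X Y] XY by blast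
    then have X: "m' \<bullet> X = 0" using that by simp
    obtain k where "Y = k *\<^sub>R X"
      using ex[of Y X] XY cross_skew[of Y X] by auto
    then have Y: "m \<bullet> Y = 0" using that by simp
    have "cross3 X S = 0" "cross3 Y S = 0"
      using cross3_self_eq_0_of_orthogonal[OF mm] X Y that m by blast+
    then show ?thesis using cross3_eq_0_scaleR S by blast
  qed
  have "\<exists>e. e * e = 1 \<and> halfturn S P1 = e *\<^sub>R P3 \<and> halfturn S P2 = e *\<^sub>R P4 \<and>
            halfturn S P3 = e *\<^sub>R P1 \<and> halfturn S P4 = e *\<^sub>R P2"
    \<comment> \<open>Either the midpoints of both diagonals lie on the axis of \<open>S\<close>, or both diagonals are parallel to it;
      then the halfturn followed by \<open>x \<mapsto> - x\<close> interchanges opposite vertices.\<close>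
  proof (cases "cross3 (P1 + P3) (P2 + P4) = 0")
    case True
    have "m \<bullet> (P1 + P3) = 0" "m' \<bullet> (P2 + P4) = 0"
      using m by (simp_all add: inner_add_right)
    then have X: "P1 + P3 = (S \<bullet> (P1 + P3)) *\<^sub>R S" "P2 + P4 = (S \<bullet> (P2 + P4)) *\<^sub>R S"
      using par[OF True ne(1) ne'(1)] by blast+
    then have "S \<bullet> (P1 - P3) = 0" "S \<bullet> (P2 - P4) = 0"
      using perp(1,4) ne ne' by (metis inner_scaleR_left mult_eq_0_iff scaleR_eq_0_iff)+
    then have "S \<bullet> P3 = S \<bullet> P1" "S \<bullet> P4 = S \<bullet> P2" by (simp_all add: inner_diff_right)
    with X have "P1 + P3 = (2 * (S \<bullet> P1)) *\<^sub>R S" "P2 + P4 = (2 * (S \<bullet> P2)) *\<^sub>R S"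
      by (simp_all add: inner_add_right)
    with \<open>S \<bullet> P3 = S \<bullet> P1\<close> \<open>S \<bullet> P4 = S \<bullet> P2\<close> show ?thesis
      by (intro exI[of _ 1]) (simp add: halfturn_def eq_diff_eq algebra_simps)
  next
    case False
    have X0: "cross3 (P1 - P3) (P2 - P4) = 0"
      using cross3_self_eq_0_of_orthogonal[OF False] perp by blast
    have "m \<bullet> (P1 - P3) = 0" "m' \<bullet> (P2 - P4) = 0"
      using m by (simp_all add: inner_diff_right)
    then have X: "P1 - P3 = (S \<bullet> (P1 - P3)) *\<^sub>R S" "P2 - P4 = (S \<bullet> (P2 - P4)) *\<^sub>R S"
      using par[OF X0 ne(2) ne'(2)] by blast+
    then have "S \<bullet> (P1 + P3) = 0" "S \<bullet> (P2 + P4) = 0"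
      using perp(1,4) ne ne' by (metis inner_scaleR_left mult_eq_0_iff scaleR_eq_0_iff inner_commute)+
    then have "S \<bullet> P3 = - (S \<bullet> P1)" "S \<bullet> P4 = - (S \<bullet> P2)" by (simp_all add: inner_add_right)
    with X have "P1 - P3 = (2 * (S \<bullet> P1)) *\<^sub>R S" "P2 - P4 = (2 * (S \<bullet> P2)) *\<^sub>R S"
      by (simp_all add: inner_diff_right)
    with \<open>S \<bullet> P3 = - (S \<bullet> P1)\<close> \<open>S \<bullet> P4 = - (S \<bullet> P2)\<close> show ?thesis
      by (intro exI[of _ "-1"]) (simp add: halfturn_def algebra_simps)
  qed
  then obtain e where e: "e * e = 1" "halfturn S P1 = e *\<^sub>R P3" "halfturn S P2 = e *\<^sub>R P4"
      "halfturn S P3 = e *\<^sub>R P1" "halfturn S P4 = e *\<^sub>R P2" by blast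
  have cr: "halfturn S (cross3 x y) = cross3 (halfturn S x) (halfturn S y)" for x y
    using rotation_about_cross3[OF halfturn_rotation(1)[OF S]] by simp
  have sc: "halfturn S (k *\<^sub>R x) = k *\<^sub>R halfturn S x" for k x
    by (simp add: halfturn_def algebra_simps)
  \<comment> \<open>The sign \<open>e\<close> occurs twice in the product and
    \<open>e * e = 1\<close> removes it.\<close>
  have "halfturn S (cross3 P1 P2) = cross3 P3 P4"
    using e by (simp add: cr cross_mult_left cross_mult_right)
  also have "\<dots> = - ((c \<bullet> cross3 P1 P2) *\<^sub>R c')"
    using cross3_self_eq[of c' P4 P3] unit orth dir cross_skew[of P3 P4] by simp
  finally have 1: "(c \<bullet> cross3 P1 P2) *\<^sub>R halfturn S c = (c \<bullet> cross3 P1 P2) *\<^sub>R (- c')"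
    using cross3_self_eq[of c P1 P2] unit orth by (metis sc scaleR_minus_right)
  have "c \<bullet> cross3 P1 P2 \<noteq> 0"
    using nz(1) cross3_self_eq[of c P1 P2] unit orth by auto
  with 1 show "halfturn S c = - c'" by (metis scaleR_left_imp_eq)
  have "halfturn S (cross3 P2 P3) = cross3 P4 P1"
    using e by (simp add: cr cross_mult_left cross_mult_right)
  also have "\<dots> = - ((d \<bullet> cross3 P2 P3) *\<^sub>R d')"
    using cross3_self_eq[of d' P1 P4] unit orth dir cross_skew[of P4 P1] by simp
  finally have 2: "(d \<bullet> cross3 P2 P3) *\<^sub>R halfturn S d = (d \<bullet> cross3 P2 P3) *\<^sub>R (- d')"
    using cross3_self_eq[of d P2 P3] unit orth by (metis sc scaleR_minus_right)
  have "d \<bullet> cross3 P2 P3 \<noteq> 0"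
    using nz(2) cross3_self_eq[of d P2 P3] unit orth by auto
  with 2 show "halfturn S d = - d'" by (metis scaleR_left_imp_eq)
qed

section \<open>Complex coordinates in the plane orthogonal to an axis\<close>

lemma all_4_iff: "(\<forall>i::4. P i) \<longleftrightarrow> P 0 \<and> P 1 \<and> P 2 \<and> P 3"
proof -
  have "(4::4) = 0" by simp
  then show ?thesis by (metis exhaust_4)
qed

text \<open>An orthogonal map commutes with the cross product up to the factor \<open>det\<close>. A
  single nonzero product carried over exactly therefore fixes the determinant without expanding
  it.\<close>

lemma orthogonal_transformation_det_1:
  fixes f :: "real^3 \<Rightarrow> real^3"
  assumes "orthogonal_transformation f" "cross3 (f x) (f y) = f (cross3 x y)" "cross3 x y \<noteq> 0"
  shows "det (matrix f) = 1"
proof -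
  have "f (cross3 x y) = det (matrix f) *\<^sub>R f (cross3 x y)"
    using cross_orthogonal_transformation[OF assms(1), of x y] assms(2) by simp
  moreover have "f (cross3 x y) \<noteq> 0"
    using assms by (metis norm_eq_zero orthogonal_transformation_norm)
  ultimately show ?thesis
    by (metis scaleR_cancel_right scaleR_one)
qed

lemma unit_mult_cnj:
  assumes "cmod z = 1"
  shows "z * cnj z = 1" "cnj z * z = 1"
  using complex_norm_square[of z] assms by (simp_all add: mult.commute)

text \<open>The vectors \<open>e\<close>, \<open>cross3 N e\<close>, \<open>N\<close> form a
  positively oriented orthonormal basis. The plane orthogonal to \<open>N\<close> is read as the
  complex plane with \<open>e\<close> as 1, so that rotations about \<open>N\<close> become
  multiplications by unit numbers.\<close>

locale planar_frame =
  fixes N e :: "real^3"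
  assumes norm_N: "norm N = 1" and norm_e: "norm e = 1" and N_e: "N \<bullet> e = 0"
begin

definition coord :: "real^3 \<Rightarrow> complex" where
  "coord x = Complex (e \<bullet> x) (cross3 N e \<bullet> x)"

definition emb :: "complex \<Rightarrow> real^3" where
  "emb w = Re w *\<^sub>R e + Im w *\<^sub>R cross3 N e"

lemma frame_inner [simp]:
  "N \<bullet> N = 1" "e \<bullet> e = 1" "N \<bullet> e = 0" "e \<bullet> N = 0" "cross3 N e \<bullet> cross3 N e = 1"
  "cross3 N e \<bullet> N = 0" "cross3 N e \<bullet> e = 0" "N \<bullet> cross3 N e = 0" "e \<bullet> cross3 N e = 0"
proof -
  show 1: "N \<bullet> N = 1" "e \<bullet> e = 1" "N \<bullet> e = 0" "e \<bullet> N = 0"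
    using norm_N norm_e N_e by (simp_all add: norm_eq_1 inner_commute)
  show "cross3 N e \<bullet> cross3 N e = 1"
    using norm_cross_dot[of N e] norm_N norm_e N_e by (simp add: dot_square_norm)
qed (simp_all add: dot_cross_self)

lemma cross3_frame: "cross3 e (cross3 N e) = N" "cross3 N (cross3 N e) = - e"
  by (simp_all add: Lagrange)

lemma frame_nz: "cross3 N e \<noteq> 0"
  using frame_inner(5) by (metis inner_zero_left zero_neq_one)

lemma N_emb [simp]: "N \<bullet> emb w = 0"
  by (simp add: emb_def inner_add_right)

lemma coord_emb [simp]: "coord (emb w) = w"
  by (simp add: emb_def coord_def inner_add_right complex_eq_iff)

text \<open>Without its components along \<open>N\<close> and \<open>e\<close>, the vector is
  orthogonal to both and hence a multiple of their cross product.\<close>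

lemma expansion: "x = emb (coord x) + (N \<bullet> x) *\<^sub>R N"
proof -
  let ?y = "x - (N \<bullet> x) *\<^sub>R N - (e \<bullet> x) *\<^sub>R e"
  have y: "N \<bullet> ?y = 0" "e \<bullet> ?y = 0"
    by (simp_all add: inner_diff_right)
  from cross3_self_eq_0_of_orthogonal[OF frame_nz y]
  have "cross3 ?y (cross3 N e) = 0" by (simp add: dot_cross_self)
  then have "?y = (cross3 N e \<bullet> ?y) *\<^sub>R cross3 N e"
    by (rule cross3_eq_0_scaleR) (simp add: norm_eq_1)
  then show ?thesis
    by (simp add: inner_diff_right coord_def emb_def algebra_simps)
qed

lemma coord_eqI: "coord x = coord y \<Longrightarrow> N \<bullet> x = N \<bullet> y \<Longrightarrow> x = y"
  by (metis expansion)

lemma emb_coord: "N \<bullet> x = 0 \<Longrightarrow> emb (coord x) = x"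
  using expansion[of x] by simp

lemma inner_coord: "x \<bullet> y = Re (coord x * cnj (coord y)) + (N \<bullet> x) * (N \<bullet> y)"
proof -
  have "x \<bullet> y = (emb (coord x) + (N \<bullet> x) *\<^sub>R N) \<bullet> (emb (coord y) + (N \<bullet> y) *\<^sub>R N)"
    using expansion by metis
  also have "\<dots> = Re (coord x * cnj (coord y)) + (N \<bullet> x) * (N \<bullet> y)"
    by (simp add: inner_add_left inner_add_right emb_def)
  finally show ?thesis .
qed

lemma norm_emb: "norm (emb w) = cmod w"
  using inner_coord[of "emb w" "emb w"]
  by (simp add: norm_eq_sqrt_inner[of "emb w"] cmod_def power2_eq_square)

lemma coord_arith: "coord (x - y) = coord x - coord y" "coord (k *\<^sub>R x) = of_real k * coord x"
    "coord (x + y) = coord x + coord y" "coord (- x) = - coord x"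
  by (simp_all add: coord_def inner_diff_right inner_add_right complex_eq_iff)

lemma coord_frame [simp]: "coord e = 1" "coord (cross3 N e) = \<i>" "coord N = 0"
  by (simp_all add: coord_def complex_eq_iff)

text \<open>In the plane the halfturn is the reflection \<open>x \<mapsto> s\<^sup>2 * cnj x\<close>
  in the line of \<open>S\<close>, and along \<open>N\<close> it is a change of sign, which the
  reversed orientation undoes. Multiplying by \<open>coord x\<close> removes the conjugate and
  expresses \<open>s\<^sup>2\<close> by a product of two coordinates.\<close>

lemma halfturn_coord:
  assumes S: "norm S = 1" "N \<bullet> S = 0" and h: "halfturn S x = - y"
  shows "N \<bullet> y = N \<bullet> x" "(coord S)\<^sup>2 * (cmod (coord x))\<^sup>2 = - (coord x * coord y)"
proof -
  have xy: "x - y = (2 * (S \<bullet> x)) *\<^sub>R S" by (rule halfturn_diff[OF h])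
  then have "N \<bullet> (x - y) = 0" using S by simp
  then show "N \<bullet> y = N \<bullet> x" by (simp add: inner_diff_right)
  let ?s = "coord S" and ?x = "coord x"
  have "cmod ?s = 1" using S norm_emb[of ?s] emb_coord by simp
  then have s: "?s * cnj ?s = 1" by (rule unit_mult_cnj)
  have "?x - coord y = of_real (2 * (S \<bullet> x)) * ?s"
    using xy by (metis coord_arith(1,2))
  also have "complex_of_real (2 * (S \<bullet> x)) = ?s * cnj ?x + cnj ?s * ?x"
    using S inner_coord[of S x] by (simp add: complex_eq_iff)
  also have "(?s * cnj ?x + cnj ?s * ?x) * ?s = ?s\<^sup>2 * cnj ?x + (?s * cnj ?s) * ?x"
    by (simp add: algebra_simps power2_eq_square)
  finally have "coord y = - (?s\<^sup>2 * cnj ?x)" using s by (simp add: algebra_simps add_eq_0_iff)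
  then have "?x * coord y = - (?s\<^sup>2 * (?x * cnj ?x))" by simp
  also have "?x * cnj ?x = (complex_of_real (cmod ?x))\<^sup>2"
    using complex_norm_square[of ?x] by simp
  finally show "?s\<^sup>2 * (cmod ?x)\<^sup>2 = - (?x * coord y)" by simp
qed

text \<open>The factor is the coordinate of the image of \<open>e\<close>. A rotation fixing
  \<open>N\<close> commutes with the cross product by \<open>N\<close>, that is, with multiplication
  by \<open>\<i>\<close>, so it is complex linear on the plane.\<close>

lemma rotation_about_coord:
  assumes "rotation_about N \<rho>"
  obtains \<zeta> where "cmod \<zeta> = 1" "\<And>x. coord (\<rho> x) = \<zeta> * coord x" "\<And>x. N \<bullet> \<rho> x = N \<bullet> x"
proof
  have o: "orthogonal_transformation \<rho>" and N: "\<rho> N = N"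
    using assms by (auto simp: rotation_about_def)
  have lin: "linear \<rho>" using o by (rule orthogonal_transformation_linear)
  show Nx: "N \<bullet> \<rho> x = N \<bullet> x" for x
    using o N by (metis orthogonal_transformation_def)
  let ?z = "coord (\<rho> e)"
  have e: "\<rho> e = emb ?z" using Nx[of e] by (simp add: emb_coord)
  then show "cmod ?z = 1"
    using norm_emb[of ?z] o norm_e by (metis orthogonal_transformation_norm)
  have "\<rho> (cross3 N e) = cross3 N (\<rho> e)"
    using rotation_about_cross3[OF assms, of N e] N by simp
  also have "\<dots> = emb (\<i> * ?z)"
    by (subst e) (simp add: emb_def cross_add_right cross_mult_right cross3_frame)
  finally have f: "coord (\<rho> (cross3 N e)) = \<i> * ?z" by simp
  show "coord (\<rho> x) = ?z * coord x" for x
  proof -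
    let ?c = "coord x"
    have "\<rho> x = \<rho> (Re ?c *\<^sub>R e + Im ?c *\<^sub>R cross3 N e + (N \<bullet> x) *\<^sub>R N)"
      using expansion[of x] by (simp add: emb_def)
    also have "\<dots> = Re ?c *\<^sub>R \<rho> e + Im ?c *\<^sub>R \<rho> (cross3 N e) + (N \<bullet> x) *\<^sub>R N"
      by (simp add: linear_add[OF lin] linear_scale[OF lin] N)
    finally have "coord (\<rho> x) = of_real (Re ?c) * ?z + of_real (Im ?c) * (\<i> * ?z)"
      by (simp add: coord_arith f)
    also have "\<dots> = ?z * ?c"
      by (simp add: complex_eq_iff)
    finally show ?thesis .
  qed
qed

lemma rotation_about_exists:
  assumes "cmod \<zeta> = 1"
  shows "rotation_about N (\<lambda>x. emb (\<zeta> * coord x) + (N \<bullet> x) *\<^sub>R N)"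
proof -
  let ?\<rho> = "\<lambda>x. emb (\<zeta> * coord x) + (N \<bullet> x) *\<^sub>R N"
  have c: "coord (?\<rho> x) = \<zeta> * coord x" and n: "N \<bullet> ?\<rho> x = N \<bullet> x" for x
    by (simp_all add: coord_arith inner_add_right)
  have lin: "linear ?\<rho>"
    by (rule linearI; rule coord_eqI) (simp_all add: coord_arith inner_add_right algebra_simps)
  have z: "\<zeta> * cnj \<zeta> = 1" using assms by (rule unit_mult_cnj)
  have "?\<rho> x \<bullet> ?\<rho> y = x \<bullet> y" for x y
  proof -
    have "\<zeta> * coord x * cnj (\<zeta> * coord y) = (\<zeta> * cnj \<zeta>) * (coord x * cnj (coord y))"
      by (simp add: algebra_simps)
    then have "\<zeta> * coord x * cnj (\<zeta> * coord y) = coord x * cnj (coord y)"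
      by (simp only: z mult_1_left)
    then show ?thesis
      by (simp only: inner_coord[of "?\<rho> x" "?\<rho> y"] c n inner_coord[of x y])
  qed
  with lin have o: "orthogonal_transformation ?\<rho>"
    by (simp add: orthogonal_transformation_def)
  have "cross3 (?\<rho> N) (?\<rho> e) = ?\<rho> (cross3 N e)"
    by (simp add: emb_def cross_add_right cross_mult_right cross3_frame)
  then have "det (matrix ?\<rho>) = 1"
    by (rule orthogonal_transformation_det_1[OF o _ frame_nz])
  with o show ?thesis by (simp add: rotation_about_def emb_def)
qed

lemma gc_reflection_emb:
  "gc_reflection (emb \<kappa>) (emb w) = emb (w - of_real (2 * Re (\<kappa> * cnj w)) * \<kappa>)"
proof -
  have "emb \<kappa> \<bullet> emb w = Re (\<kappa> * cnj w)" by (simp add: inner_coord[of "emb \<kappa>"])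
  then show ?thesis
    by (simp add: gc_reflection_def emb_def algebra_simps scaleR_diff_left)
qed

text \<open>A vector orthogonal to \<open>N\<close> is orthogonal to \<open>x\<close> iff it is at
  right angles to the planar part of \<open>x\<close>, hence the factor \<open>\<i>\<close>. The
  hypothesis excludes that \<open>x\<close> is a multiple of \<open>N\<close>.\<close>

lemma great_circle_Int:
  assumes "coord x \<noteq> 0"
  defines "w \<equiv> \<i> * sgn (coord x)"
  shows "great_circle N \<inter> great_circle x = {emb w, emb (- w)}"
proof -
  let ?x = "coord x"
  have cw: "cmod w = 1" using assms by (simp add: w_def norm_mult norm_sgn)
  have xw: "?x = - \<i> * of_real (cmod ?x) * w"
  proof -
    have "of_real (cmod ?x) * sgn ?x = ?x" using assms(1) by (simp add: sgn_eq)
    moreover have "- \<i> * c * (\<i> * s) = c * s" for c s by (simp add: complex_eq_iff)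
    ultimately show ?thesis unfolding w_def by metis
  qed
  have "emb w \<in> great_circle x" "emb (- w) \<in> great_circle x"
  proof -
    have "Re (?x * cnj w) = 0" "Re (?x * cnj (- w)) = 0"
      unfolding w_def using complex_norm_square[of ?x]
      by (simp_all add: sgn_eq)
    then show "emb w \<in> great_circle x" "emb (- w) \<in> great_circle x"
      using cw by (simp_all only: great_circle_def norm_emb inner_coord[of x] N_emb coord_emb) (simp_all add: norm_emb)
  qed
  moreover have "y \<in> {emb w, emb (- w)}" if y: "y \<in> great_circle N" "y \<in> great_circle x" for y
  proof -
    have N: "N \<bullet> y = 0" and ny: "norm y = 1" and xy: "x \<bullet> y = 0"
      using y by (simp_all add: great_circle_def)
    let ?y = "coord y"
    have ey: "emb ?y = y" using N by (rule emb_coord)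
    have cy: "cmod ?y = 1" using ny norm_emb[of ?y] ey by simp
    have "Re (?x * cnj ?y) = 0" using xy N by (simp add: inner_coord[of x])
    then have "Im (w * cnj ?y) = 0"
      using assms(1) by (subst (asm) xw) (simp add: mult.assoc)
    moreover have "cmod (w * cnj ?y) = 1" using cw cy by (simp add: norm_mult)
    ultimately have "w * cnj ?y = 1 \<or> w * cnj ?y = - 1"
      by (auto simp: complex_eq_iff cmod_def abs_if split: if_splits)
    moreover have "w = w * cnj ?y * ?y"
      using cy by (simp add: mult.assoc unit_mult_cnj)
    ultimately have "?y = w \<or> ?y = - w" by (metis minus_minus mult_1_left mult_minus_left)
    then show ?thesis using ey by auto
  qed
  ultimately show ?thesis
    using cw by (auto simp: great_circle_def norm_emb)
qed

end

section \<open>Linkages related by halfturns\<close>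

text \<open>What remains of a non-aligned pose once the joints are forgotten: each splitting of the
  indices into a pair for \<open>a\<close> and the complementary pair for \<open>b\<close> has a
  halfturn that exchanges both pairs of poles with reversal.\<close>

locale halfturn_linkage =
  fixes a b :: "4 \<Rightarrow> real^3" and S :: "nat \<Rightarrow> real^3"
  assumes norm_a: "norm (a i) = 1" and norm_b: "norm (b i) = 1"
    and norm_S: "m \<in> {1..6} \<Longrightarrow> norm (S m) = 1"
    and inj_a: "i \<noteq> j \<Longrightarrow> a i \<noteq> a j" and inj_b: "i \<noteq> j \<Longrightarrow> b i \<noteq> b j"
    and halfturn_a: "halfturn (S 1) (a 0) = - a 3" "halfturn (S 2) (a 0) = - a 1"
      "halfturn (S 3) (a 0) = - a 2" "halfturn (S 4) (a 1) = - a 2"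
      "halfturn (S 5) (a 2) = - a 3" "halfturn (S 6) (a 1) = - a 3"
    and halfturn_b: "halfturn (S 1) (b 1) = - b 2" "halfturn (S 2) (b 2) = - b 3"
      "halfturn (S 3) (b 1) = - b 3" "halfturn (S 4) (b 3) = - b 0"
      "halfturn (S 5) (b 1) = - b 0" "halfturn (S 6) (b 2) = - b 0"
begin

lemma orthogonal_iff:
  assumes "halfturn s x = - y" "x \<noteq> y"
  shows "N \<bullet> s = 0 \<longleftrightarrow> N \<bullet> x = N \<bullet> y"
proof -
  have "x - y = (2 * (s \<bullet> x)) *\<^sub>R s" by (rule halfturn_diff[OF assms(1)])
  moreover from this have "s \<bullet> x \<noteq> 0" using assms(2) by auto
  moreover from calculation have "N \<bullet> x - N \<bullet> y = (2 * (s \<bullet> x)) * (N \<bullet> s)"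
    by (metis inner_diff_right inner_scaleR_right)
  ultimately show ?thesis by auto
qed

text \<open>The normal is the cross product of \<open>S 1\<close> and \<open>S 2\<close>. Poles
  exchanged by a halfturn have equal height over this plane iff the axis lies in it. This gives
  equal heights first for \<open>b 1\<close>, \<open>b 2\<close>, \<open>b 3\<close>, hence
  \<open>S 3\<close> in the plane, then for all \<open>a i\<close>, hence the other three
  centers.\<close>

lemma centers_coplanar: "\<exists>N. norm N = 1 \<and> (\<forall>m\<in>{1..6}. N \<bullet> S m = 0)"
proof -
  let ?M = "cross3 (S 1) (S 2)"
  \<comment> \<open>Parallel axes would define the same halfturn, and the images
    \<open>- a 3\<close> and \<open>- a 1\<close> of \<open>a 0\<close> would agree.\<close>
  have nz: "?M \<noteq> 0"
  proof
    assume "?M = 0"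
    then have "S 1 = S 2 \<or> S 1 = - S 2"
      using unit_cross3_eq_0[of "S 1" "S 2"] norm_S by simp
    then have "halfturn (S 1) (a 0) = halfturn (S 2) (a 0)" by (auto simp: halfturn_def)
    then show False using halfturn_a(1,2) inj_a[of 1 3] by simp
  qed
  have 12: "?M \<bullet> S 1 = 0" "?M \<bullet> S 2 = 0" by (simp_all add: dot_cross_self)
  have "?M \<bullet> b 1 = ?M \<bullet> b 2" "?M \<bullet> b 2 = ?M \<bullet> b 3"
    using 12 orthogonal_iff[OF halfturn_b(1)] orthogonal_iff[OF halfturn_b(2)] inj_b by auto
  then have 3: "?M \<bullet> S 3 = 0"
    using orthogonal_iff[OF halfturn_b(3)] inj_b by auto
  have "?M \<bullet> a 0 = ?M \<bullet> a 1" "?M \<bullet> a 0 = ?M \<bullet> a 2" "?M \<bullet> a 0 = ?M \<bullet> a 3"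
    using 12 3 orthogonal_iff[OF halfturn_a(1)] orthogonal_iff[OF halfturn_a(2)]
      orthogonal_iff[OF halfturn_a(3)] inj_a by auto
  then have 456: "?M \<bullet> S 4 = 0" "?M \<bullet> S 5 = 0" "?M \<bullet> S 6 = 0"
    using orthogonal_iff[OF halfturn_a(4)] orthogonal_iff[OF halfturn_a(5)]
      orthogonal_iff[OF halfturn_a(6)] inj_a by auto
  have "{1..6} = {1, 2, 3, 4, 5, 6::nat}" by auto
  then have "\<forall>m\<in>{1..6}. (?M /\<^sub>R norm ?M) \<bullet> S m = 0"
    using 12 3 456 by simp
  moreover have "norm (?M /\<^sub>R norm ?M) = 1" using nz by simp
  ultimately show ?thesis by blast
qed

end

locale planar_halfturn_linkage = halfturn_linkage + planar_frame +
  assumes N_S: "m \<in> {1..6} \<Longrightarrow> N \<bullet> S m = 0"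
begin

abbreviation "\<xi> i \<equiv> coord (a i)"
abbreviation "\<upsilon> i \<equiv> coord (b i)"
text \<open>The radii are read off at index 0; \<open>cmod_coord\<close> shows them to be common to
  all indices.\<close>

definition "ra = cmod (\<xi> 0)"
definition "rb = cmod (\<upsilon> 0)"

lemma N_S': "N \<bullet> S 1 = 0" "N \<bullet> S 2 = 0" "N \<bullet> S 3 = 0" "N \<bullet> S 4 = 0" "N \<bullet> S 5 = 0" "N \<bullet> S 6 = 0"
  by (simp_all add: N_S)

lemma norm_S': "norm (S 1) = 1" "norm (S 2) = 1" "norm (S 3) = 1" "norm (S 4) = 1" "norm (S 5) = 1"
  "norm (S 6) = 1"
  by (simp_all add: norm_S)

lemmas hc_a = halfturn_coord[OF norm_S'(1) N_S'(1) halfturn_a(1)]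
  halfturn_coord[OF norm_S'(2) N_S'(2) halfturn_a(2)] halfturn_coord[OF norm_S'(3) N_S'(3) halfturn_a(3)]
  halfturn_coord[OF norm_S'(4) N_S'(4) halfturn_a(4)] halfturn_coord[OF norm_S'(5) N_S'(5) halfturn_a(5)]
  halfturn_coord[OF norm_S'(6) N_S'(6) halfturn_a(6)]

lemmas hc_b = halfturn_coord[OF norm_S'(1) N_S'(1) halfturn_b(1)]
  halfturn_coord[OF norm_S'(2) N_S'(2) halfturn_b(2)] halfturn_coord[OF norm_S'(3) N_S'(3) halfturn_b(3)]
  halfturn_coord[OF norm_S'(4) N_S'(4) halfturn_b(4)] halfturn_coord[OF norm_S'(5) N_S'(5) halfturn_b(5)]
  halfturn_coord[OF norm_S'(6) N_S'(6) halfturn_b(6)]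

section \<open>Constant height, radius and coordinate product\<close>

lemma height: "N \<bullet> a i = N \<bullet> a 0" "N \<bullet> b i = N \<bullet> b 0"
proof -
  have "\<forall>i. N \<bullet> a i = N \<bullet> a 0" "\<forall>i. N \<bullet> b i = N \<bullet> b 0"
    unfolding all_4_iff using hc_a(1,3,5,7,9,11) hc_b(1,3,5,7,9,11) by simp_all
  then show "N \<bullet> a i = N \<bullet> a 0" "N \<bullet> b i = N \<bullet> b 0" by blast+
qed

lemma cmod_coord: "cmod (\<xi> i) = ra" "cmod (\<upsilon> i) = rb"
proof -
  have sq: "(cmod (coord x))\<^sup>2 = x \<bullet> x - (N \<bullet> x)\<^sup>2" for x
    unfolding inner_coord[of x x] by (simp add: cmod_power2) (simp add: power2_eq_square)
  have "a i \<bullet> a i = a 0 \<bullet> a 0" "b i \<bullet> b i = b 0 \<bullet> b 0"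
    using norm_a norm_b by (simp_all add: norm_eq_1[symmetric] dot_square_norm)
  then have "(cmod (\<xi> i))\<^sup>2 = (cmod (\<xi> 0))\<^sup>2" "(cmod (\<upsilon> i))\<^sup>2 = (cmod (\<upsilon> 0))\<^sup>2"
    unfolding sq using height(1)[of i] height(2)[of i] by simp_all
  then show "cmod (\<xi> i) = ra" "cmod (\<upsilon> i) = rb"
    by (simp_all add: ra_def rb_def)
qed

text \<open>With radius 0, all poles of a family would lie on the axis at the same height and so
  coincide.\<close>

lemma radius_pos: "0 < ra" "0 < rb"
proof -
  have "ra \<noteq> 0"
  proof
    assume "ra = 0"
    then have "\<xi> 0 = \<xi> 1" using cmod_coord(1)[of 0] cmod_coord(1)[of 1] by simp
    then show False using coord_eqI[of "a 0" "a 1"] height(1)[of 1] inj_a[of 0 1] by simp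
  qed
  then show "0 < ra" using ra_def by simp
  have "rb \<noteq> 0"
  proof
    assume "rb = 0"
    then have "\<upsilon> 0 = \<upsilon> 1" using cmod_coord(2)[of 0] cmod_coord(2)[of 1] by simp
    then show False using coord_eqI[of "b 0" "b 1"] height(2)[of 1] inj_b[of 0 1] by simp
  qed
  then show "0 < rb" using rb_def by simp
qed

lemma coord_nz: "\<xi> i \<noteq> 0" "\<upsilon> i \<noteq> 0"
  using cmod_coord(1)[of i] cmod_coord(2)[of i] radius_pos by auto

text \<open>Elimination of \<open>s\<close>, the squared coordinate of a center, from its relations
  to the two pairs of poles.\<close>

lemma product_transfer:
  fixes A B :: complex
  assumes "s * A = - (x * x')" "s * B = - (y * y')"
  shows "x * x' * B = y * y' * A"
proof -
  have "x * x' * B = - (s * A) * B" using assms(1) by simp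
  also have "\<dots> = - (s * B) * A" by (simp add: algebra_simps)
  finally show ?thesis using assms(2) by simp
qed

text \<open>Each center makes a product of two \<open>\<xi>\<close> and the product of the two
  complementary \<open>\<upsilon>\<close> proportional, with a factor given by the radii. Dividing
  two such relations that share one \<open>\<xi>\<close> and one \<open>\<upsilon>\<close> shows
  that the ratios of the \<open>\<xi>\<close> are reciprocal to those of the
  \<open>\<upsilon>\<close>.\<close>

lemma coord_product: "\<xi> i * \<upsilon> i = \<xi> 0 * \<upsilon> 0"
proof -
  note r = hc_a(2,4,6,8,10,12)[unfolded cmod_coord] hc_b(2,4,6,8,10,12)[unfolded cmod_coord]
  have 2: "\<xi> 0 * \<xi> 1 * rb\<^sup>2 = \<upsilon> 2 * \<upsilon> 3 * ra\<^sup>2" by (rule product_transfer[OF r(2) r(8)])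
  have 3: "\<xi> 0 * \<xi> 2 * rb\<^sup>2 = \<upsilon> 1 * \<upsilon> 3 * ra\<^sup>2" by (rule product_transfer[OF r(3) r(9)])
  have 4: "\<xi> 1 * \<xi> 2 * rb\<^sup>2 = \<upsilon> 3 * \<upsilon> 0 * ra\<^sup>2" by (rule product_transfer[OF r(4) r(10)])
  have 6: "\<xi> 1 * \<xi> 3 * rb\<^sup>2 = \<upsilon> 2 * \<upsilon> 0 * ra\<^sup>2" by (rule product_transfer[OF r(6) r(12)])
  have key: "x * y = x' * y'"
    if "x * z * rb\<^sup>2 = y' * w * ra\<^sup>2" "x' * z * rb\<^sup>2 = y * w * ra\<^sup>2" "z \<noteq> 0" "w \<noteq> 0" for x x' y y' z w :: complex
  proof -
    have "(x * z * rb\<^sup>2) * (y * w * ra\<^sup>2) = (y' * w * ra\<^sup>2) * (x' * z * rb\<^sup>2)"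
      using that by simp
    then have "(x * y) * (z * w * rb\<^sup>2 * ra\<^sup>2) = (x' * y') * (z * w * rb\<^sup>2 * ra\<^sup>2)"
      by (simp add: algebra_simps)
    then show ?thesis using that radius_pos by simp
  qed
  have "\<forall>i. \<xi> i * \<upsilon> i = \<xi> 0 * \<upsilon> 0"
    unfolding all_4_iff
    using key[of "\<xi> 1" "\<xi> 2" "\<upsilon> 0" "\<upsilon> 3" "\<xi> 0" "\<upsilon> 1"] key[of "\<xi> 2" "\<xi> 1" "\<upsilon> 0" "\<upsilon> 3" "\<xi> 0" "\<upsilon> 2"]
      key[of "\<xi> 3" "\<xi> 1" "\<upsilon> 0" "\<upsilon> 2" "\<xi> 0" "\<upsilon> 3"] 2 3 4 6 coord_nz
    by (simp add: mult.commute)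
  then show ?thesis by blast
qed

text \<open>Equal heights and radii leave exactly one rotation, multiplication by
  \<open>\<xi> i / \<xi> 0\<close>. By \<open>coord_product\<close> this ratio is also
  \<open>\<upsilon> 0 / \<upsilon> i\<close>.\<close>

lemma rotation_swap:
  "(\<exists>!\<rho>. rotation_about N \<rho> \<and> \<rho> (a 0) = a i) \<and>
   (\<forall>\<rho>. rotation_about N \<rho> \<and> \<rho> (a 0) = a i \<longrightarrow> \<rho> (b i) = b 0)"
proof -
  let ?z = "\<xi> i / \<xi> 0"
  let ?\<rho> = "\<lambda>x. emb (?z * coord x) + (N \<bullet> x) *\<^sub>R N"
  have z: "cmod ?z = 1" using cmod_coord radius_pos by (simp add: norm_divide)
  have ex: "rotation_about N ?\<rho>" by (rule rotation_about_exists[OF z])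
  have a: "?\<rho> (a 0) = a i"
    using coord_nz expansion[of "a i"] height(1)[of i] by simp
  have uniq: "\<rho> = ?\<rho>" if \<rho>: "rotation_about N \<rho>" "\<rho> (a 0) = a i" for \<rho>
  proof -
    obtain z' where z': "\<And>x. coord (\<rho> x) = z' * coord x" "\<And>x. N \<bullet> \<rho> x = N \<bullet> x"
      using rotation_about_coord[OF \<rho>(1)] by metis
    have "z' = ?z" using z'(1)[of "a 0"] \<rho>(2) coord_nz by (simp add: field_simps)
    then have "\<rho> x = ?\<rho> x" for x
      by (intro coord_eqI) (simp_all add: z' coord_arith inner_add_right)
    then show ?thesis by blast
  qed
  have b: "?\<rho> (b i) = b 0"
  proof -
    have "?z * \<upsilon> i = \<upsilon> 0" using coord_product[of i] coord_nz by (simp add: field_simps)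
    then show ?thesis using expansion[of "b 0"] height(2)[of i] by simp
  qed
  show ?thesis
  proof (intro conjI ex1I[of _ ?\<rho>] allI impI)
    show "\<rho> = ?\<rho>" if "rotation_about N \<rho> \<and> \<rho> (a 0) = a i" for \<rho>
      using uniq that by blast
    show "\<rho> (b i) = b 0" if "rotation_about N \<rho> \<and> \<rho> (a 0) = a i" for \<rho>
      using uniq[of \<rho>] that b by simp
  qed (fact ex a)+
qed

text \<open>The mirror with normal \<open>emb \<kappa>\<close> acts on the plane by
  \<open>w \<mapsto> - (\<kappa>\<^sup>2 * cnj w)\<close>. As \<open>\<kappa>\<^sup>2\<close> is the
  normalized constant product up to sign, the direction of \<open>\<xi> i\<close> goes to that of
  \<open>\<upsilon> i\<close> up to sign, and an antipodal pair does not notice the sign.\<close>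

lemma reflection_swap:
  assumes \<kappa>: "cmod \<kappa> = 1" and sq: "\<kappa>\<^sup>2 * (ra * rb) = \<epsilon> * (\<xi> 0 * \<upsilon> 0)" and \<epsilon>: "\<epsilon> = 1 \<or> \<epsilon> = - 1"
  shows "gc_reflection (emb \<kappa>) ` (great_circle N \<inter> great_circle (a i)) = great_circle N \<inter> great_circle (b i)"
    and "gc_reflection (emb \<kappa>) ` (great_circle N \<inter> great_circle (b i)) = great_circle N \<inter> great_circle (a i)"
proof -
  have R: "gc_reflection (emb \<kappa>) (emb w) = emb (- (\<kappa>\<^sup>2 * cnj w))" for w
  proof -
    have "of_real (2 * Re (\<kappa> * cnj w)) * \<kappa> = (\<kappa> * cnj w + cnj \<kappa> * w) * \<kappa>"
      by (simp add: complex_eq_iff)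
    also have "\<dots> = \<kappa>\<^sup>2 * cnj w + (\<kappa> * cnj \<kappa>) * w" by (simp add: algebra_simps power2_eq_square)
    finally have "w - of_real (2 * Re (\<kappa> * cnj w)) * \<kappa> = - (\<kappa>\<^sup>2 * cnj w)"
      using unit_mult_cnj(1)[OF \<kappa>] by simp
    then show ?thesis by (simp only: gc_reflection_emb)
  qed
  have swap: "\<kappa>\<^sup>2 * cnj (sgn x) = \<epsilon> * sgn y"
    if "x * y = \<xi> 0 * \<upsilon> 0" "cmod x * cmod y = ra * rb" for x y
  proof -
    have nz: "x \<noteq> 0" "y \<noteq> 0" using that(2) radius_pos by auto
    have xx: "x * cnj x = (of_real (cmod x))\<^sup>2" using complex_norm_square[of x] by simp
    have "\<kappa>\<^sup>2 * of_real (cmod x * cmod y) * cnj x = \<epsilon> * y * (x * cnj x)"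
      using sq that by (simp add: algebra_simps)
    then have "\<kappa>\<^sup>2 * (cmod y * cnj x) * cmod x = \<epsilon> * y * cmod x * cmod x"
      unfolding xx by (simp add: power2_eq_square algebra_simps)
    then have "\<kappa>\<^sup>2 * (cmod y * cnj x) = \<epsilon> * y * cmod x"
      using nz by simp
    then show ?thesis using nz by (simp add: sgn_eq field_simps)
  qed
  have "cmod (\<upsilon> i) * cmod (\<xi> i) = ra * rb" "cmod (\<xi> i) * cmod (\<upsilon> i) = ra * rb"
    by (simp_all add: cmod_coord)
  from swap[OF _ this(1)] swap[OF _ this(2)]
  have s: "\<kappa>\<^sup>2 * cnj (sgn (\<xi> i)) = \<epsilon> * sgn (\<upsilon> i)" "\<kappa>\<^sup>2 * cnj (sgn (\<upsilon> i)) = \<epsilon> * sgn (\<xi> i)"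
    using coord_product[of i] by (simp_all add: mult.commute)
  have s': "\<kappa>\<^sup>2 * cnj (\<i> * sgn (\<xi> i)) = - (\<epsilon> * (\<i> * sgn (\<upsilon> i)))"
      "\<kappa>\<^sup>2 * cnj (\<i> * sgn (\<upsilon> i)) = - (\<epsilon> * (\<i> * sgn (\<xi> i)))"
    using s by (simp_all add: mult.left_commute[of _ \<i>])
  show "gc_reflection (emb \<kappa>) ` (great_circle N \<inter> great_circle (a i)) = great_circle N \<inter> great_circle (b i)"
    "gc_reflection (emb \<kappa>) ` (great_circle N \<inter> great_circle (b i)) = great_circle N \<inter> great_circle (a i)"
    using \<epsilon> unfolding great_circle_Int[OF coord_nz(1)] great_circle_Int[OF coord_nz(2)]
    by (auto simp: R s' simp del: complex_cnj_mult) 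
qed

lemma card_Int: "card (great_circle N \<inter> great_circle (a i)) = 2" "card (great_circle N \<inter> great_circle (b i)) = 2"
proof -
  have "emb w \<noteq> emb (- w)" if "w \<noteq> 0" for w
  proof
    assume "emb w = emb (- w)"
    then have "w = - w" using coord_emb[of w] coord_emb[of "- w"] by simp
    then show False using that by (simp add: complex_eq_iff)
  qed
  then show "card (great_circle N \<inter> great_circle (a i)) = 2" "card (great_circle N \<inter> great_circle (b i)) = 2"
    unfolding great_circle_Int[OF coord_nz(1)] great_circle_Int[OF coord_nz(2)]
    using coord_nz[of i] by (simp_all add: sgn_zero_iff)
qed

lemma orthogonal_mirrors:
  "\<exists>c1 c2. norm c1 = 1 \<and> norm c2 = 1 \<and> c1 \<bullet> c2 = 0 \<and>
     N \<in> great_circle c1 \<inter> great_circle c2 \<and>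
     (\<forall>i. \<forall>c\<in>{c1, c2}.
       gc_reflection c ` (great_circle N \<inter> great_circle (a i)) = great_circle N \<inter> great_circle (b i) \<and>
       gc_reflection c ` (great_circle N \<inter> great_circle (b i)) = great_circle N \<inter> great_circle (a i))"
proof -
  \<comment> \<open>The square root realizes \<open>\<epsilon> = 1\<close>, and
    \<open>\<i> * \<kappa>\<close>, at right angles to it, realizes \<open>\<epsilon> = - 1\<close>.
    The product under the root is the same for every index, so one pair of mirrors serves
    all.\<close>
  define \<kappa> where "\<kappa> = csqrt (\<xi> 0 * \<upsilon> 0 / (ra * rb))"
  have sq: "\<kappa>\<^sup>2 = \<xi> 0 * \<upsilon> 0 / (ra * rb)" by (simp add: \<kappa>_def)
  have "cmod (\<kappa>\<^sup>2) = 1"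
    using radius_pos cmod_coord[of 0] unfolding sq by (simp add: norm_mult norm_divide)
  then have \<kappa>: "cmod \<kappa> = 1"
    by (metis abs_norm_cancel norm_power power2_eq_1_iff abs_1 abs_minus_cancel)
  have 1: "\<kappa>\<^sup>2 * (ra * rb) = 1 * (\<xi> 0 * \<upsilon> 0)" "(\<i> * \<kappa>)\<^sup>2 * (ra * rb) = (- 1) * (\<xi> 0 * \<upsilon> 0)"
    using radius_pos sq by (simp_all add: power_mult_distrib)
  have i\<kappa>: "cmod (\<i> * \<kappa>) = 1" using \<kappa> by (simp add: norm_mult)
  have "emb \<kappa> \<bullet> emb (\<i> * \<kappa>) = 0" by (simp add: inner_coord[of "emb \<kappa>"])
  moreover have "N \<in> great_circle (emb \<kappa>) \<inter> great_circle (emb (\<i> * \<kappa>))"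
    using norm_N by (simp add: great_circle_def inner_commute[of _ N])
  ultimately show ?thesis
    using \<kappa> i\<kappa> reflection_swap[OF \<kappa> 1(1)] reflection_swap[OF i\<kappa> 1(2)]
    by (intro exI[of _ "emb \<kappa>"] exI[of _ "emb (\<i> * \<kappa>)"]) (auto simp: norm_emb)
qed

end

section \<open>Rotations given by quaternions\<close>

text \<open>Rotations preserve cross products, so the agreement extends to the cross product of the
  pair, which completes a basis.\<close>

lemma rotation_matrix_eqI:
  fixes A B :: "real^3^3"
  assumes A: "rotation_matrix A" and B: "rotation_matrix B"
    and xy: "norm x = 1" "norm y = 1" "x \<bullet> y = 0" "A *v x = B *v x" "A *v y = B *v y"
  shows "A = B"
proof -
  interpret planar_frame x y using xy by unfold_locales
  have c: "A *v cross3 x y = B *v cross3 x y"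
    using cross_rotation_matrix[OF A, of x y] cross_rotation_matrix[OF B, of x y] xy by simp
  have "A *v z = B *v z" for z
    by (subst (1 2) expansion[of z])
      (simp add: emb_def matrix_vector_right_distrib matrix_vector_mult_scaleR c xy)
  then show ?thesis by (simp add: matrix_eq)
qed

text \<open>Each pair is taken to the third and first unit vectors by a matrix with orthonormal
  rows; one such matrix is followed by the inverse of the other.\<close>

lemma orthonormal_pair_rotation:
  fixes c x c' x' :: "real^3"
  assumes "norm c = 1" "norm x = 1" "c \<bullet> x = 0" "norm c' = 1" "norm x' = 1" "c' \<bullet> x' = 0"
  obtains A where "rotation_matrix A" "A *v c = c'" "A *v x = x'"
proof -
  have frame: "\<exists>B. rotation_matrix B \<and> B *v c = axis 3 1 \<and> B *v x = axis 1 1"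
    if c: "norm c = 1" "norm x = 1" "c \<bullet> x = 0" for c x :: "real^3"
  proof -
    interpret planar_frame c x using c by unfold_locales
    define B :: "real^3^3" where "B = vector [x, cross3 c x, c]"
    have r: "row 1 B = x" "row 2 B = cross3 c x" "row 3 B = c"
      by (simp_all add: B_def row_def vec_eq_iff)
    have "orthogonal_matrix B"
      unfolding orthogonal_matrix_orthonormal_rows forall_3 r
      using c by (simp add: orthogonal_def norm_eq_1)
    moreover have "det B = x \<bullet> cross3 (cross3 c x) c"
      by (simp add: B_def dot_cross_det)
    moreover have "cross3 (cross3 c x) c = x"
      using cross_skew[of "cross3 c x" c] by (simp add: cross3_frame Lagrange)
    moreover have "B *v c = axis 3 1" "B *v x = axis 1 1"
      by (simp_all add: B_def vec_eq_iff forall_3 matrix_vector_mult_def axis_def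
          inner_vec_def[symmetric] row_def[symmetric] inner_real_def[symmetric] del: inner_real_def)
    ultimately show ?thesis by (auto simp: rotation_matrix_def)
  qed
  obtain B where B: "rotation_matrix B" "B *v c = axis 3 1" "B *v x = axis 1 1"
    using frame assms by blast
  obtain B' where B': "rotation_matrix B'" "B' *v c' = axis 3 1" "B' *v x' = axis 1 1"
    using frame assms by blast
  have t: "transpose B' ** B' = mat 1"
    using B'(1) by (simp add: rotation_matrix_def orthogonal_matrix_def)
  have "transpose B' *v axis 3 1 = c'" "transpose B' *v axis 1 1 = x'"
    using t B' by (metis matrix_vector_mul_assoc matrix_vector_mul_lid)+
  then have "(transpose B' ** B) *v c = c'" "(transpose B' ** B) *v x = x'"
    using B by (simp_all only: matrix_vector_mul_assoc[symmetric])
  moreover have "rotation_matrix (transpose B' ** B)"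
    using B B' by (simp add: rotation_matrix_def orthogonal_matrix_mul det_mul orthogonal_matrix_transpose)
  ultimately show thesis using that by blast
qed

section \<open>Rotations from unnormalized quaternions in complex form\<close>

definition equator :: "complex \<Rightarrow> real^3" where
  "equator w = vector [Re w, Im w, 0]"

abbreviation pole :: "real^3" where "pole \<equiv> axis 3 1"

lemma equator_components [simp]:
  "equator w $ 1 = Re w" "equator w $ 2 = Im w" "equator w $ 3 = 0"
  by (simp_all add: equator_def)

lemma pole_components [simp]: "pole $ 1 = 0" "pole $ 2 = 0" "pole $ 3 = 1"
  by (simp_all add: axis_def)

lemma norm_equator [simp]: "norm (equator w) = cmod w"
  by (simp add: norm_eq_sqrt_inner[of "equator w"] inner_vec_def sum_3 cmod_def power2_eq_square)

lemma pole_equator [simp]: "pole \<bullet> equator w = 0" "equator w \<bullet> pole = 0"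
  by (simp_all add: inner_vec_def sum_3)

lemma cross3_pole_equator: "cross3 pole (equator w) = equator (\<i> * w)"
  by (simp add: cross3_def vec_eq_iff forall_3)

text \<open>The rotation given by the (not normalized) quaternion \<open>s + x i + y j + k k\<close>, where \<open>\<sigma> = s + k \<i>\<close>
  and \<open>z = x + y \<i>\<close>, is \<open>quat \<sigma> z\<close>.\<close>

definition qmat :: "complex \<Rightarrow> complex \<Rightarrow> real^3^3" where
  "qmat \<sigma> z = (let s = Re \<sigma>; k = Im \<sigma>; x = Re z; y = Im z in
     vector [vector [s\<^sup>2 + x\<^sup>2 - y\<^sup>2 - k\<^sup>2, 2 * (x * y - s * k), 2 * (x * k + s * y)],
             vector [2 * (x * y + s * k), s\<^sup>2 - x\<^sup>2 + y\<^sup>2 - k\<^sup>2, 2 * (y * k - s * x)],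
             vector [2 * (x * k - s * y), 2 * (y * k + s * x), s\<^sup>2 - x\<^sup>2 - y\<^sup>2 + k\<^sup>2]])"

definition qnorm :: "complex \<Rightarrow> complex \<Rightarrow> real" where
  "qnorm \<sigma> z = (cmod \<sigma>)\<^sup>2 + (cmod z)\<^sup>2"

definition quat :: "complex \<Rightarrow> complex \<Rightarrow> real^3^3" where
  "quat \<sigma> z = (1 / qnorm \<sigma> z) *\<^sub>R qmat \<sigma> z"

text \<open>The quaternion \<open>1 + z\<close>. For \<open>z = t * w\<close> with real
  \<open>t\<close> and \<open>cmod w = 1\<close> it turns about \<open>equator w\<close> through the
  angle whose half has tangent \<open>t\<close>; halfturns are out of reach.\<close>

abbreviation turn :: "complex \<Rightarrow> real^3^3" where "turn \<equiv> quat 1"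

lemma qnorm_expand: "qnorm \<sigma> z = (Re \<sigma>)\<^sup>2 + (Im \<sigma>)\<^sup>2 + (Re z)\<^sup>2 + (Im z)\<^sup>2"
  by (simp add: qnorm_def cmod_power2)

lemma qnorm_pos: "\<sigma> \<noteq> 0 \<Longrightarrow> 0 < qnorm \<sigma> z"
  by (simp add: qnorm_def add_pos_nonneg)

lemma qmat_components:
  "qmat \<sigma> z $ 1 $ 1 = (Re \<sigma>)\<^sup>2 + (Re z)\<^sup>2 - (Im z)\<^sup>2 - (Im \<sigma>)\<^sup>2"
  "qmat \<sigma> z $ 1 $ 2 = 2 * (Re z * Im z - Re \<sigma> * Im \<sigma>)"
  "qmat \<sigma> z $ 1 $ 3 = 2 * (Re z * Im \<sigma> + Re \<sigma> * Im z)"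
  "qmat \<sigma> z $ 2 $ 1 = 2 * (Re z * Im z + Re \<sigma> * Im \<sigma>)"
  "qmat \<sigma> z $ 2 $ 2 = (Re \<sigma>)\<^sup>2 - (Re z)\<^sup>2 + (Im z)\<^sup>2 - (Im \<sigma>)\<^sup>2"
  "qmat \<sigma> z $ 2 $ 3 = 2 * (Im z * Im \<sigma> - Re \<sigma> * Re z)"
  "qmat \<sigma> z $ 3 $ 1 = 2 * (Re z * Im \<sigma> - Re \<sigma> * Im z)"
  "qmat \<sigma> z $ 3 $ 2 = 2 * (Im z * Im \<sigma> + Re \<sigma> * Re z)"
  "qmat \<sigma> z $ 3 $ 3 = (Re \<sigma>)\<^sup>2 - (Re z)\<^sup>2 - (Im z)\<^sup>2 + (Im \<sigma>)\<^sup>2"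
  by (simp_all add: qmat_def Let_def)

lemma scaleR_matrix_mult: "(c *\<^sub>R A) ** (d *\<^sub>R B) = (c * d) *\<^sub>R (A ** B)"
  for A :: "real^'n^'m" and B :: "real^'k^'n"
  by (simp add: vec_eq_iff matrix_matrix_mult_def sum_distrib_left ac_simps)

lemma mat_1_components:
  "(mat 1 :: real^3^3) $ 1 $ 1 = 1" "(mat 1 :: real^3^3) $ 1 $ 2 = 0" "(mat 1 :: real^3^3) $ 1 $ 3 = 0"
  "(mat 1 :: real^3^3) $ 2 $ 1 = 0" "(mat 1 :: real^3^3) $ 2 $ 2 = 1" "(mat 1 :: real^3^3) $ 2 $ 3 = 0"
  "(mat 1 :: real^3^3) $ 3 $ 1 = 0" "(mat 1 :: real^3^3) $ 3 $ 2 = 0" "(mat 1 :: real^3^3) $ 3 $ 3 = 1"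
  by (simp_all add: mat_def)

lemma transpose_qmat: "transpose (qmat \<sigma> z) ** qmat \<sigma> z = (qnorm \<sigma> z)\<^sup>2 *\<^sub>R mat 1"
  unfolding vec_eq_iff forall_3 matrix_matrix_mult_def transpose_def sum_3 vec_lambda_beta
    qmat_components qnorm_expand vector_scaleR_component mat_1_components real_scaleR_def
  by (intro conjI; algebra)

lemma rotation_quat:
  assumes "\<sigma> \<noteq> 0"
  shows "rotation_matrix (quat \<sigma> z)"
proof -
  let ?n = "qnorm \<sigma> z"
  have n: "?n \<noteq> 0" using qnorm_pos[OF assms, of z] by simp
  have "transpose (quat \<sigma> z) = (1 / ?n) *\<^sub>R transpose (qmat \<sigma> z)"
    by (simp add: quat_def vec_eq_iff transpose_def)
  then have "transpose (quat \<sigma> z) ** quat \<sigma> z = mat 1"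
    using n by (simp add: quat_def scaleR_matrix_mult transpose_qmat power2_eq_square)
  then have o: "orthogonal_matrix (quat \<sigma> z)" by (simp add: orthogonal_matrix)
  define s k x y where d: "s = Re \<sigma>" "k = Im \<sigma>" "x = Re z" "y = Im z"
  have col: "quat \<sigma> z *v axis j 1 = (1 / ?n) *\<^sub>R (\<chi> i. qmat \<sigma> z $ i $ j)" for j
    by (simp add: quat_def vec_eq_iff matrix_vector_mult_basis column_def)
  \<comment> \<open>After normalization the third column is the cross product of the first two, as
    the determinant criterion requires.\<close>
  have "cross3 (\<chi> i. qmat \<sigma> z $ i $ 1) (\<chi> i. qmat \<sigma> z $ i $ 2) = ?n *\<^sub>R (\<chi> i. qmat \<sigma> z $ i $ 3)"
    unfolding vec_eq_iff forall_3 cross3_def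
    by (simp add: qmat_components qnorm_expand flip: d) (intro conjI; algebra)
  then have "cross3 (quat \<sigma> z *v axis 1 1) (quat \<sigma> z *v axis 2 1) = quat \<sigma> z *v cross3 (axis 1 1) (axis 2 1)"
    using n by (simp add: col cross_basis cross_mult_left cross_mult_right)
  moreover have "orthogonal_transformation ((*v) (quat \<sigma> z))" "cross3 (axis 1 1) (axis 2 1) \<noteq> (0::real^3)"
    by (simp_all add: o orthogonal_transformation_matrix cross_basis axis_eq_0_iff)
  ultimately have "det (matrix ((*v) (quat \<sigma> z))) = 1"
    by (intro orthogonal_transformation_det_1)
  with o show ?thesis by (simp add: rotation_matrix_def)
qed

lemma rotation_turn: "rotation_matrix (turn z)"
  by (rule rotation_quat) simp

lemma turn_equator: "turn (of_real t * w) *v equator w = equator w"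
proof -
  have "qmat 1 (of_real t * w) *v equator w = qnorm 1 (of_real t * w) *\<^sub>R equator w"
    by (simp add: vec_eq_iff forall_3 matrix_vector_mult_def sum_3 qmat_components qnorm_expand)
      (simp add: algebra_simps power2_eq_square)
  then show ?thesis
    using qnorm_pos[of 1 "of_real t * w"] by (simp add: quat_def scaleR_matrix_vector_assoc[symmetric])
qed

text \<open>The quaternion product of \<open>1 + a\<close> and \<open>1 - b\<close>, whose scalar
  and vertical parts are collected in \<open>1 + a * cnj b\<close> and whose horizontal part is
  \<open>a - b\<close>; the norms multiply.\<close>

lemma turn_turn: "turn a ** turn (- b) = quat (1 + a * cnj b) (a - b)"
proof -
  have "qmat 1 a ** qmat 1 (- b) = qmat (1 + a * cnj b) (a - b)"
    by (simp add: vec_eq_iff forall_3 matrix_matrix_mult_def sum_3 qmat_components)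
      (simp add: algebra_simps power2_eq_square)
  moreover have "qnorm 1 a * qnorm 1 (- b) = qnorm (1 + a * cnj b) (a - b)"
    by (simp add: qnorm_expand) (simp add: algebra_simps power2_eq_square)
  moreover have "turn a ** turn (- b) = (1 / (qnorm 1 a * qnorm 1 (- b))) *\<^sub>R (qmat 1 a ** qmat 1 (- b))"
    by (simp add: quat_def matrix_scalar_ac scalar_matrix_assoc mult.commute flip: scalar_mult_eq_scaleR)
  ultimately show ?thesis by (simp add: quat_def)
qed

lemma quat_components:
  "quat \<sigma> z $ i $ j = qmat \<sigma> z $ i $ j / qnorm \<sigma> z"
  by (simp add: quat_def)

lemma turn_inverse: "turn a ** turn (- a) = mat 1"
proof -
  have "1 + a * cnj a = of_real (1 + (cmod a)\<^sup>2)"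
    using complex_norm_square[of a] by simp
  moreover have "quat (of_real m) 0 = mat 1" if "m \<noteq> 0" for m :: real
    using that unfolding vec_eq_iff forall_3 mat_1_components quat_components
    by (simp add: qmat_components qnorm_expand)
  moreover have "1 + (cmod a)\<^sup>2 \<noteq> 0"
    by (metis add_nonneg_eq_0_iff zero_le_one zero_le_power2 zero_neq_one)
  ultimately have "quat (1 + a * cnj a) 0 = mat 1" by metis
  then show ?thesis by (simp add: turn_turn)
qed

text \<open>The matrix entries give back \<open>\<sigma>\<^sup>2\<close> and
  \<open>cnj \<sigma> * z\<close>, both divided by the norm. The first determines
  \<open>\<sigma>\<close> up to a real factor of either sign; as \<open>\<sigma>\<close> is nonzero,
  the second then gives \<open>z\<close> the same factor.\<close>

lemma quat_eqD:
  assumes nz: "\<sigma> \<noteq> 0" "\<sigma>' \<noteq> 0" and eq: "quat \<sigma> z = quat \<sigma>' z'"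
  obtains \<mu> where "\<sigma>' = of_real \<mu> * \<sigma>" "z' = of_real \<mu> * z"
proof -
  let ?n = "qnorm \<sigma> z" and ?n' = "qnorm \<sigma>' z'"
  have n: "?n > 0" "?n' > 0" using nz by (simp_all add: qnorm_pos)
  have entries: "Complex (A $ 1 $ 1 + A $ 2 $ 2) (A $ 2 $ 1 - A $ 1 $ 2) = 2 * \<sigma>\<^sup>2 / qnorm \<sigma> z \<and>
      Complex (A $ 3 $ 2) (- A $ 3 $ 1) = 2 * (cnj \<sigma> * z) / qnorm \<sigma> z"
    if "A = quat \<sigma> z" for A \<sigma> z
    unfolding that quat_components qmat_components
    by (simp add: complex_eq_iff Re_power2 Im_power2 add_divide_distrib[symmetric] diff_divide_distrib[symmetric])
      (simp add: power2_eq_square algebra_simps minus_divide_left)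
  have "2 * \<sigma>\<^sup>2 / ?n = 2 * \<sigma>'\<^sup>2 / ?n'" "2 * (cnj \<sigma> * z) / ?n = 2 * (cnj \<sigma>' * z') / ?n'"
    using entries[OF refl, of \<sigma> z] entries[OF eq] by auto
  then have sq: "\<sigma>'\<^sup>2 * of_real ?n = \<sigma>\<^sup>2 * of_real ?n'"
      and sz: "cnj \<sigma>' * z' * of_real ?n = cnj \<sigma> * z * of_real ?n'"
    using n by (simp_all add: field_simps)
  define q where "q = sqrt (?n' / ?n)"
  have q: "q > 0" "?n' = q\<^sup>2 * ?n" using n by (simp_all add: q_def)
  have "\<sigma>'\<^sup>2 * of_real ?n = (of_real q * \<sigma>)\<^sup>2 * of_real ?n"
    unfolding sq by (subst q(2)) (simp add: power_mult_distrib)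
  then have "\<sigma>'\<^sup>2 = (of_real q * \<sigma>)\<^sup>2" using n by simp
  then have "\<sigma>' = of_real q * \<sigma> \<or> \<sigma>' = of_real (- q) * \<sigma>"
    by (simp add: power2_eq_iff)
  then obtain \<mu> :: real where \<mu>: "\<sigma>' = of_real \<mu> * \<sigma>" "\<mu> \<noteq> 0" "?n' = \<mu>\<^sup>2 * ?n"
    using q by (metis less_irrefl neg_equal_0_iff_equal power2_minus)
  have "(of_real \<mu> * cnj \<sigma> * of_real ?n) * z' = (of_real \<mu> * cnj \<sigma> * of_real ?n) * (of_real \<mu> * z)"
    using sz unfolding \<mu>(3) unfolding \<mu>(1) by (simp add: power2_eq_square ac_simps)
  moreover have "of_real \<mu> * cnj \<sigma> * of_real ?n \<noteq> (0::complex)" using \<mu> nz n by simp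
  ultimately have "z' = of_real \<mu> * z"
    by (simp only: mult_cancel_left) simp
  with \<mu>(1) show thesis using that by blast
qed

text \<open>Equal rotations have proportional quaternions. Since 1 and the non-real \<open>D\<close>
  are independent over the reals, comparing \<open>1 + m' * D\<close> with a multiple of
  \<open>1 + m * D\<close> forces the factor 1.\<close>

lemma turn_turn_eqD:
  assumes "turn a ** turn (- b) = turn a' ** turn (- b')"
    and "a * cnj b = of_real m * D" "a' * cnj b' = of_real m' * D" "Im D \<noteq> 0"
  shows "m = m'" "a - b = a' - b'"
proof -
  have nz: "1 + of_real m * D \<noteq> 0" for m
    using assms(4) by (auto simp: complex_eq_iff)
  have "quat (1 + of_real m * D) (a - b) = quat (1 + of_real m' * D) (a' - b')"
    using assms(1) unfolding turn_turn assms(2,3) .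
  then obtain \<mu> where \<mu>: "1 + of_real m' * D = of_real \<mu> * (1 + of_real m * D)" "a' - b' = of_real \<mu> * (a - b)"
    using quat_eqD[OF nz nz] by metis
  from \<mu>(1) have "1 + m' * Re D = \<mu> * (1 + m * Re D)" "m' * Im D = \<mu> * m * Im D"
    by (simp_all add: complex_eq_iff algebra_simps)
  then have "m' = \<mu> * m" "\<mu> = 1" using assms(4) by (auto simp: algebra_simps)
  then show "m = m'" "a - b = a' - b'" using \<mu> by simp_all
qed

section \<open>Rotations about an axis in the equator\<close>

lemma matrix_vector_pole: "(C *v pole) $ i = C $ i $ 3" for C :: "real^3^'n"
  by (simp add: matrix_vector_mult_basis column_def)

text \<open>The image of the pole stays orthogonal to the fixed axis; \<open>s\<close> and
  \<open>C $ 3 $ 3\<close> are the sine and the cosine of the angle of rotation.\<close>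

lemma rotation_fixing_equator_column:
  assumes C: "rotation_matrix C" and fixes_w: "C *v equator w = equator w" and w: "cmod w = 1"
  defines "s \<equiv> Re (cnj w * Complex (- C $ 2 $ 3) (C $ 1 $ 3))"
  shows "C $ 1 $ 3 = Im w * s" "C $ 2 $ 3 = - (Re w * s)" "s\<^sup>2 + (C $ 3 $ 3)\<^sup>2 = 1"
proof -
  have ww: "(Re w)\<^sup>2 + (Im w)\<^sup>2 = 1" using w cmod_power2[of w] by simp
  have "equator w \<bullet> (C *v pole) = 0"
    using rotation_matrix_inner[OF C, of "equator w" pole] unfolding fixes_w by simp
  then have o: "Re w * C $ 1 $ 3 + Im w * C $ 2 $ 3 = 0"
    by (simp add: inner_vec_def[of "equator w"] sum_3 matrix_vector_pole)
  have "(C *v pole) \<bullet> (C *v pole) = 1"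
    using rotation_matrix_inner[OF C, of pole pole] by (simp add: inner_axis)
  then have u: "(C $ 1 $ 3)\<^sup>2 + (C $ 2 $ 3)\<^sup>2 + (C $ 3 $ 3)\<^sup>2 = 1"
    by (simp add: inner_vec_def sum_3 matrix_vector_pole power2_eq_square)
  have s: "s = Im w * C $ 1 $ 3 - Re w * C $ 2 $ 3" by (simp add: s_def)
  show c1: "C $ 1 $ 3 = Im w * s" using ww o unfolding s by algebra
  show c2: "C $ 2 $ 3 = - (Re w * s)" using ww o unfolding s by algebra
  show "s\<^sup>2 + (C $ 3 $ 3)\<^sup>2 = 1" using u ww unfolding c1 c2 by algebra
qed

text \<open>The real factor is the half-angle tangent, sine over 1 plus cosine, and
  \<open>nz\<close> excludes the halfturn. Both rotations fix the axis, so it is enough to compare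
  the images of the pole.\<close>

lemma rotation_fixing_equator:
  assumes C: "rotation_matrix C" and fixes_w: "C *v equator w = equator w" and w: "cmod w = 1"
    and nz: "C $ 3 $ 3 \<noteq> - 1"
  shows "C = turn (of_real (Re (cnj w * Complex (- C $ 2 $ 3) (C $ 1 $ 3)) / (1 + C $ 3 $ 3)) * w)"
proof -
  define c s t where "c = C $ 3 $ 3" and "s = Re (cnj w * Complex (- C $ 2 $ 3) (C $ 1 $ 3))" and "t = s / (1 + c)"
  have ww: "(Re w)\<^sup>2 + (Im w)\<^sup>2 = 1" using w cmod_power2[of w] by simp
  note c1 = rotation_fixing_equator_column(1)[OF C fixes_w w, folded s_def]
    and c2 = rotation_fixing_equator_column(2)[OF C fixes_w w, folded s_def]
    and sc = rotation_fixing_equator_column(3)[OF C fixes_w w, folded s_def c_def]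
  have nz': "1 + c \<noteq> 0" using nz by (simp add: c_def)
  have t: "t * (1 + c) = s" using nz' by (simp add: t_def)
  have "(1 + c) * ((1 + c) * (1 + t\<^sup>2)) = (1 + c)\<^sup>2 + (t * (1 + c))\<^sup>2"
    by (simp add: power2_eq_square algebra_simps)
  also have "\<dots> = (1 + c) * 2"
    unfolding t using sc by (simp add: power2_eq_square algebra_simps)
  finally have "(1 + c) * ((1 + c) * (1 + t\<^sup>2)) = (1 + c) * 2" .
  then have n: "(1 + c) * (1 + t\<^sup>2) = 2" using nz' mult_cancel_left by blast
  have st: "s * (1 + t\<^sup>2) = 2 * t" using n unfolding t[symmetric] by (simp add: mult.assoc)
  have ct: "c * (1 + t\<^sup>2) = 1 - t\<^sup>2" using n by (simp add: algebra_simps)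
  have n0: "1 + t\<^sup>2 \<noteq> 0" using n by auto
  have qn: "qnorm 1 (of_real t * w) = 1 + t\<^sup>2"
    using w by (simp add: qnorm_def norm_mult)
  have "turn (of_real t * w) *v pole = C *v pole"
  proof -
    have "turn (of_real t * w) $ 1 $ 3 = C $ 1 $ 3"
    proof -
      have "2 * (t * Im w) = Im w * s * (1 + t\<^sup>2)" by (simp add: mult.assoc st)
      then show ?thesis unfolding quat_components qmat_components qn c1 using n0 by (simp add: field_simps)
    qed
    moreover have "turn (of_real t * w) $ 2 $ 3 = C $ 2 $ 3"
    proof -
      have "2 * (t * Re w) = Re w * s * (1 + t\<^sup>2)" by (simp add: mult.assoc st)
      then show ?thesis unfolding quat_components qmat_components qn c2 using n0 by (simp add: field_simps)
    qed
    moreover have "turn (of_real t * w) $ 3 $ 3 = C $ 3 $ 3"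
    proof -
      have "1 - (t * Re w)\<^sup>2 - (t * Im w)\<^sup>2 = 1 - t\<^sup>2 * ((Re w)\<^sup>2 + (Im w)\<^sup>2)"
        by (simp add: power_mult_distrib algebra_simps)
      then have "1 - (t * Re w)\<^sup>2 - (t * Im w)\<^sup>2 = c * (1 + t\<^sup>2)" unfolding ww ct by simp
      then show ?thesis unfolding quat_components qmat_components qn c_def[symmetric] using n0 by (simp add: field_simps)
    qed
    ultimately show ?thesis by (simp add: vec_eq_iff forall_3 matrix_vector_pole)
  qed
  then have "C = turn (of_real t * w)"
    using w by (intro rotation_matrix_eqI[OF C rotation_turn, of pole "equator w"])
      (simp_all add: turn_equator fixes_w)
  then show ?thesis by (simp add: t_def s_def c_def)
qed

section \<open>Closure equations of the aligned linkage\<close>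

lemma distinct_of_set_4:
  assumes "{i, j, k, l} = {0, 1, 2, 3 :: 4}"
  shows "distinct [i, j, k, l]"
proof (rule card_distinct)
  have "card {0, 1, 2, 3 :: 4} = 4" by simp
  then show "card (set [i, j, k, l]) = length [i, j, k, l]" using assms by simp
qed

lemma ex_fourth_index:
  assumes "i \<noteq> k" "i \<noteq> l" "k \<noteq> (l::4)"
  obtains j where "{i, j, k, l} = {0, 1, 2, 3}"
proof -
  have u: "(UNIV :: 4 set) = {0, 1, 2, 3}"
    using all_4_iff[of "\<lambda>i. i \<in> {0, 1, 2, 3}"] by auto
  have "card {i, k, l} \<noteq> card (UNIV :: 4 set)"
    using assms by simp
  then obtain j where j: "j \<notin> {i, k, l}" by (metis UNIV_eq_I)
  have "card {i, j, k, l} = card (UNIV :: 4 set)"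
    using assms j by (auto simp: card_insert_if)
  then have "{i, j, k, l} = UNIV"
    by (intro card_subset_eq) simp_all
  then show thesis by (intro that[of j]) (simp only: u)
qed

lemma turn_inverse': "turn (- a) ** turn a = mat 1"
  using turn_inverse[of "- a"] by simp

text \<open>Distinct squares mean that no two of the \<open>T i\<close>, and no two of the
  \<open>S k\<close>, are equal or opposite. This encodes side lengths strictly between 0 and
  pi.\<close>

locale aligned_linkage =
  fixes T S :: "4 \<Rightarrow> complex"
  assumes unit_T: "cmod (T i) = 1" and unit_S: "cmod (S k) = 1"
    and T_sq: "i \<noteq> j \<Longrightarrow> (T i)\<^sup>2 \<noteq> (T j)\<^sup>2" and S_sq: "k \<noteq> l \<Longrightarrow> (S k)\<^sup>2 \<noteq> (S l)\<^sup>2"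
begin

abbreviation joint :: "4 \<Rightarrow> 4 \<Rightarrow> complex" where "joint i k \<equiv> T i * S k"

definition closed_up :: "(4 \<Rightarrow> 4 \<Rightarrow> real) \<Rightarrow> bool" where
  "closed_up t \<longleftrightarrow> (\<forall>i j k l. {i, j, k, l} = {0, 1, 2, 3} \<longrightarrow>
     t i k * t j k = t i l * t j l \<and>
     t i k * joint i k - t j k * joint j k = t i l * joint i l - t j l * joint j l)"

definition linked :: "(4 \<Rightarrow> real^3^3) \<Rightarrow> (4 \<Rightarrow> real^3^3) \<Rightarrow> (4 \<Rightarrow> 4 \<Rightarrow> real) \<Rightarrow> bool" where
  "linked q p t \<longleftrightarrow> (\<forall>i k. i \<noteq> k \<longrightarrow> p k = q i ** turn (t i k * joint i k))"

lemma unit_joint: "cmod (joint i k) = 1"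
  by (simp add: norm_mult unit_T unit_S)

lemma joint_cnj:
  "of_real x * joint i k * cnj (of_real y * joint j k) = of_real (x * y) * (T i * cnj (T j))"
proof -
  have "of_real x * joint i k * cnj (of_real y * joint j k) = of_real (x * y) * (T i * cnj (T j)) * (S k * cnj (S k))"
    by (simp add: ac_simps)
  then show ?thesis using unit_mult_cnj[OF unit_S] by simp
qed

text \<open>A real unit number is 1 or -1, which would make the squares equal. This supplies the
  non-real \<open>D\<close> of \<open>turn_turn_eqD\<close>.\<close>

lemma Im_T:
  assumes "i \<noteq> j"
  shows "Im (T i * cnj (T j)) \<noteq> 0"
proof
  define z where "z = T i * cnj (T j)"
  assume "Im (T i * cnj (T j)) = 0"
  then have z: "z = of_real (Re z)" by (simp add: z_def complex_eq_iff)
  have "cmod z = 1" by (simp add: z_def norm_mult unit_T)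
  then have "(Re z)\<^sup>2 = 1" by (subst (asm) z) (simp add: abs_square_eq_1)
  then have "z\<^sup>2 = 1" by (subst z) (simp flip: of_real_power)
  moreover have "z\<^sup>2 * (T j)\<^sup>2 = (T i)\<^sup>2 * (T j * cnj (T j))\<^sup>2"
    by (simp add: z_def power_mult_distrib ac_simps)
  ultimately have "(T j)\<^sup>2 = (T i)\<^sup>2" using unit_mult_cnj[OF unit_T] by simp
  then show False using T_sq assms by metis
qed

text \<open>The bar on \<open>g\<^sub>j\<close> is reached from that on \<open>g\<^sub>i\<close>
  through \<open>h\<^sub>k\<close> and through \<open>h\<^sub>l\<close>. By \<open>joint_cnj\<close>
  both routes involve the same number \<open>T i * cnj (T j)\<close>, so
  \<open>turn_turn_eqD\<close> splits the equality of rotations into the two closure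
  equations.\<close>

lemma linked_closed_up:
  assumes q: "\<And>i. rotation_matrix (q i)" and link: "linked q p t"
  shows "closed_up t"
  unfolding closed_up_def
proof (intro allI impI)
  fix i j k l :: 4 assume ijkl: "{i, j, k, l} = {0, 1, 2, 3}"
  have d: "i \<noteq> j" "i \<noteq> k" "i \<noteq> l" "j \<noteq> k" "j \<noteq> l" "k \<noteq> l"
    using distinct_of_set_4[OF ijkl] by auto
  have qj: "q j = q i ** (turn (t i m * joint i m) ** turn (- (t j m * joint j m)))" if "m \<noteq> i" "m \<noteq> j" for m
  proof -
    have "q i ** turn (t i m * joint i m) = q j ** turn (t j m * joint j m)"
      using link that unfolding linked_def by metis
    then have "q i ** turn (t i m * joint i m) ** turn (- (t j m * joint j m))
        = q j ** (turn (t j m * joint j m) ** turn (- (t j m * joint j m)))"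
      by (simp add: matrix_mul_assoc)
    then show ?thesis by (simp add: turn_inverse matrix_mul_assoc)
  qed
  have "transpose (q i) ** q i = mat 1"
    using q[of i] by (simp add: rotation_matrix_def orthogonal_matrix_def)
  then have cancel: "X = Y" if "q i ** X = q i ** Y" for X Y
    by (metis that matrix_mul_assoc matrix_mul_lid)
  have "turn (t i k * joint i k) ** turn (- (t j k * joint j k)) = turn (t i l * joint i l) ** turn (- (t j l * joint j l))"
    by (rule cancel) (rule trans[OF qj[symmetric] qj]; use d in simp)
  from turn_turn_eqD[OF this joint_cnj joint_cnj Im_T[OF d(1)]]
  show "t i k * t j k = t i l * t j l \<and>
     t i k * joint i k - t j k * joint j k = t i l * joint i l - t j l * joint j l" by blast
qed

lemma closed_up_turn:
  assumes "closed_up t" "{i, j, k, l} = {0, 1, 2, 3}"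
  shows "turn (t i k * joint i k) ** turn (- (t j k * joint j k)) = turn (t i l * joint i l) ** turn (- (t j l * joint j l))"
  using assms unfolding turn_turn closed_up_def joint_cnj by metis

section \<open>Scaling and proportionality of solutions\<close>

lemma closed_up_scale:
  assumes "closed_up t"
  shows "closed_up (\<lambda>i k. \<mu> * t i k)"
  unfolding closed_up_def
proof (intro allI impI)
  fix i j k l :: 4 assume "{i, j, k, l} = {0, 1, 2, 3}"
  then have e: "t i k * t j k = t i l * t j l"
      "t i k * joint i k - t j k * joint j k = t i l * joint i l - t j l * joint j l"
    using assms unfolding closed_up_def by blast+
  have "\<mu> * t i k * (\<mu> * t j k) = \<mu>\<^sup>2 * (t i k * t j k)" "\<mu> * t i l * (\<mu> * t j l) = \<mu>\<^sup>2 * (t i l * t j l)"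
    by (simp_all add: power2_eq_square)
  moreover have "of_real (\<mu> * t i k) * joint i k - of_real (\<mu> * t j k) * joint j k = of_real \<mu> * (t i k * joint i k - t j k * joint j k)"
    "of_real (\<mu> * t i l) * joint i l - of_real (\<mu> * t j l) * joint j l = of_real \<mu> * (t i l * joint i l - t j l * joint j l)"
    by (simp_all add: algebra_simps)
  ultimately show "\<mu> * t i k * (\<mu> * t j k) = \<mu> * t i l * (\<mu> * t j l) \<and>
     of_real (\<mu> * t i k) * joint i k - of_real (\<mu> * t j k) * joint j k = of_real (\<mu> * t i l) * joint i l - of_real (\<mu> * t j l) * joint j l"
    by (simp only: e)
qed

text \<open>Squared moduli of the linear equation, together with the product equation, show that the
  sum and the difference of the tangents at \<open>k\<close> agree up to sign with those at
  \<open>l\<close>. Two of the four sign choices relate opposite joints as claimed; the other two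
  are impossible.\<close>

lemma isogram_opposite:
  assumes t: "closed_up t" and nz: "\<And>i k. i \<noteq> k \<Longrightarrow> t i k \<noteq> 0" and ijkl: "{i, j, k, l} = {0, 1, 2, 3}"
  obtains \<epsilon> where "\<epsilon> * \<epsilon> = 1" "t j l = \<epsilon> * t i k" "t i l = \<epsilon> * t j k"
proof -
  have d: "i \<noteq> j" "i \<noteq> k" "i \<noteq> l" "j \<noteq> k" "j \<noteq> l" "k \<noteq> l"
    using distinct_of_set_4[OF ijkl] by auto
  have e: "t i k * t j k = t i l * t j l"
      "t i k * joint i k - t j k * joint j k = t i l * joint i l - t j l * joint j l"
    using t ijkl unfolding closed_up_def by blast+
  have n: "(cmod (x * joint i m - y * joint j m))\<^sup>2 = x\<^sup>2 + y\<^sup>2 - 2 * (x * y) * Re (T i * cnj (T j))" for x y :: real and m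
  proof -
    have "(cmod (x * joint i m - y * joint j m))\<^sup>2 = (cmod (of_real x * joint i m))\<^sup>2 + (cmod (of_real y * joint j m))\<^sup>2
        - 2 * Re (of_real x * joint i m * cnj (of_real y * joint j m))"
      unfolding cmod_power2 by (simp add: power2_eq_square algebra_simps)
    then show ?thesis unfolding joint_cnj norm_mult[of "of_real _"] unit_joint by simp
  qed
  have sq: "(t i k)\<^sup>2 + (t j k)\<^sup>2 = (t i l)\<^sup>2 + (t j l)\<^sup>2"
    using n[of "t i k" k "t j k"] n[of "t i l" l "t j l"] unfolding e by simp
  have "(t i k + t j k)\<^sup>2 = (t i l + t j l)\<^sup>2" "(t i k - t j k)\<^sup>2 = (t i l - t j l)\<^sup>2"
    using sq e(1) by (simp_all add: power2_sum power2_diff)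
  then have "(t i k + t j k = t i l + t j l \<or> t i k + t j k = - (t i l + t j l)) \<and>
      (t i k - t j k = t i l - t j l \<or> t i k - t j k = - (t i l - t j l))"
    by (simp add: power2_eq_iff)
  \<comment> \<open>In this case the linear equation factors, so that
    \<open>S k = \<epsilon> * S l\<close> or, by comparing moduli,
    \<open>(T i)\<^sup>2 = (T j)\<^sup>2\<close>.\<close>
  moreover have False if "t i k = \<epsilon> * t i l" "t j k = \<epsilon> * t j l" "\<epsilon> = 1 \<or> \<epsilon> = - 1" for \<epsilon>
  proof -
    have eps: "t i l = \<epsilon> * t i k" "t j l = \<epsilon> * t j k" "\<epsilon>\<^sup>2 = 1" using that by auto
    have "(S k - \<epsilon> * S l) * (t i k * T i - t j k * T j) = 0"
      using e(2) unfolding eps by (simp add: algebra_simps)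
    moreover have "S k - \<epsilon> * S l \<noteq> 0"
    proof
      assume "S k - \<epsilon> * S l = 0"
      then have "(S k)\<^sup>2 = (of_real \<epsilon>)\<^sup>2 * (S l)\<^sup>2" by (simp add: power_mult_distrib)
      then have "(S k)\<^sup>2 = (S l)\<^sup>2" using that(3) by auto
      then show False using S_sq d by blast
    qed
    ultimately have tt: "t i k * T i = t j k * T j" by simp
    then have "\<bar>t i k\<bar> = \<bar>t j k\<bar>"
      by (metis norm_mult unit_T mult.right_neutral norm_of_real)
    then have "(t i k)\<^sup>2 = (t j k)\<^sup>2" using power2_eq_iff abs_eq_iff by blast
    moreover have "(of_real (t i k))\<^sup>2 * (T i)\<^sup>2 = (of_real (t j k))\<^sup>2 * (T j)\<^sup>2"
      using tt by (metis power_mult_distrib)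
    ultimately have "(T i)\<^sup>2 = (T j)\<^sup>2"
      using nz d by (metis mult_cancel_left of_real_eq_0_iff of_real_power power_not_zero)
    then show False using T_sq d by blast
  qed
  from this[of 1] this[of "- 1"] have "\<not> (t i k = t i l \<and> t j k = t j l)" "\<not> (t i k = - t i l \<and> t j k = - t j l)"
    by auto
  ultimately have "(t j l = t i k \<and> t i l = t j k) \<or> (t j l = - t i k \<and> t i l = - t j k)"
    by argo
  then show thesis using that[of 1] that[of "- 1"] by auto
qed

text \<open>Once the opposite tangents are eliminated, the linear equation has coefficients that
  depend only on the joints and on the sign \<open>\<epsilon>\<close>. By \<open>pos\<close> both
  solutions have the same sign, so they satisfy the same equation.\<close>

lemma isogram_ratio:
  assumes t: "closed_up t" and t': "closed_up t'" and pos: "\<And>i k. i \<noteq> k \<Longrightarrow> 0 < t i k * t' i k"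
    and ijkl: "{i, j, k, l} = {0, 1, 2, 3}"
  shows "t i k * t' j k = t j k * t' i k" "t i k * t' i l = t i l * t' i k"
proof -
  have d: "i \<noteq> j" "i \<noteq> k" "i \<noteq> l" "j \<noteq> k" "j \<noteq> l" "k \<noteq> l"
    using distinct_of_set_4[OF ijkl] by auto
  have nz: "t i k \<noteq> 0" "t' i k \<noteq> 0" if "i \<noteq> k" for i k using pos[OF that] by auto
  obtain \<epsilon> where \<epsilon>: "\<epsilon> * \<epsilon> = 1" "t j l = \<epsilon> * t i k" "t i l = \<epsilon> * t j k"
    by (rule isogram_opposite[OF t nz(1) ijkl])
  obtain \<epsilon>' where \<epsilon>': "\<epsilon>' * \<epsilon>' = 1" "t' j l = \<epsilon>' * t' i k" "t' i l = \<epsilon>' * t' j k"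
    by (rule isogram_opposite[OF t' nz(2) ijkl])
  have "0 < (\<epsilon> * \<epsilon>') * (t i k * t' i k)"
    using pos[OF d(5)] unfolding \<epsilon> \<epsilon>' by (simp add: ac_simps)
  then have "\<epsilon> * \<epsilon>' > 0" using pos[OF d(2)] zero_less_mult_pos2 by blast
  moreover have "(\<epsilon> - \<epsilon>') * (\<epsilon> + \<epsilon>') = 0" using \<epsilon>(1) \<epsilon>'(1) by (simp add: algebra_simps)
  then have "\<epsilon>' = \<epsilon> \<or> \<epsilon> = - \<epsilon>'" by (auto simp: eq_neg_iff_add_eq_0)
  ultimately have ee: "\<epsilon>' = \<epsilon>" using \<epsilon>'(1) by auto
  let ?X = "joint i k + \<epsilon> * joint j l" and ?Y = "joint j k + \<epsilon> * joint i l"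
  have eq: "t i k * ?X = t j k * ?Y"
  proof -
    have "t i k * joint i k - t j k * joint j k = t i l * joint i l - t j l * joint j l"
      using t ijkl unfolding closed_up_def by blast
    then show ?thesis unfolding \<epsilon> by (simp add: algebra_simps)
  qed
  have eq': "t' i k * ?X = t' j k * ?Y"
  proof -
    have "t' i k * joint i k - t' j k * joint j k = t' i l * joint i l - t' j l * joint j l"
      using t' ijkl unfolding closed_up_def by blast
    then show ?thesis unfolding \<epsilon>' ee by (simp add: algebra_simps)
  qed
  \<comment> \<open>Otherwise both coefficients vanish, and multiplying the two resulting equations
    gives \<open>(T j)\<^sup>2 = (T i)\<^sup>2\<close>.\<close>
  have X: "?X \<noteq> 0"
  proof
    assume X: "?X = 0"
    then have "?Y = 0" using eq nz[OF d(4)] by simp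
    then have "T j * S k = - (\<epsilon> * (T i * S l))" "T i * S k = - (\<epsilon> * (T j * S l))"
      using X by (simp_all add: eq_neg_iff_add_eq_0)
    then have "(T j * S k) * (T j * S l) = (T i * S l) * (T i * S k)" by simp
    then have "(T j)\<^sup>2 * (S k * S l) = (T i)\<^sup>2 * (S k * S l)"
      by (simp add: power2_eq_square ac_simps)
    moreover have "S k * S l \<noteq> 0" using unit_S by (metis mult_eq_0_iff norm_zero zero_neq_one)
    ultimately show False using T_sq d by simp
  qed
  have "of_real (t i k * t' j k) * ?X = t' j k * (t i k * ?X)" by (simp add: ac_simps)
  also have "\<dots> = t j k * (t' j k * ?Y)" unfolding eq by (simp add: ac_simps)
  also have "\<dots> = of_real (t j k * t' i k) * ?X" unfolding eq'[symmetric] by (simp add: ac_simps)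
  finally have "complex_of_real (t i k * t' j k) = of_real (t j k * t' i k)"
    using X mult_right_cancel by blast
  then show 1: "t i k * t' j k = t j k * t' i k" using of_real_eq_iff by blast
  show "t i k * t' i l = t i l * t' i k"
    unfolding \<epsilon> \<epsilon>' ee using 1 by (simp add: ac_simps)
qed

text \<open>By \<open>isogram_ratio\<close> the quotient of the two solutions is constant along the
  rows and the columns of the table of twelve joints.\<close>

lemma closed_up_proportional:
  assumes t: "closed_up t" and t': "closed_up t'" and pos: "\<And>i k. i \<noteq> k \<Longrightarrow> 0 < t i k * t' i k"
    and ik: "i \<noteq> k"
  shows "t' i k = t' 0 1 / t 0 1 * t i k"
proof -
  have nz: "t i k \<noteq> 0" if "i \<noteq> k" for i k using pos[OF that] by auto
  define \<rho> where "\<rho> i k = t' i k / t i k" for i k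
  have row: "\<rho> i k = \<rho> i l" if ne: "i \<noteq> k" "i \<noteq> l" for i k l
  proof (cases "k = l")
    case False
    obtain j where "{i, j, k, l} = {0, 1, 2, 3}"
      by (rule ex_fourth_index[OF ne False])
    from isogram_ratio(2)[OF t t' pos this] show ?thesis
      using nz ne by (simp add: \<rho>_def field_simps)
  qed simp
  have col: "\<rho> i k = \<rho> j k" if ne: "i \<noteq> k" "j \<noteq> k" for i j k
  proof (cases "i = j")
    case False
    obtain l where "{i, l, j, k} = {0, 1, 2, 3}"
      by (rule ex_fourth_index[OF False ne])
    then have "{i, j, k, l} = {0, 1, 2, 3}" by (metis insert_commute)
    from isogram_ratio(1)[OF t t' pos this] show ?thesis
      using nz ne by (simp add: \<rho>_def field_simps)
  qed simp
  have "\<rho> i k = \<rho> 0 1"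
  proof (cases "k = 0")
    case True
    \<comment> \<open>The place (0, 0) carries no joint, so column 0 is connected with
      \<open>\<rho> 0 1\<close> by a detour through a column \<open>m\<close> other than 0 and
      \<open>i\<close>.\<close>
    define m :: 4 where "m = (if i = 1 then 2 else 1)"
    have "m \<noteq> i" "m \<noteq> 0" by (auto simp: m_def)
    then show ?thesis using row[of i k m] col[of i m 0] row[of 0 m 1] True ik by simp
  next
    case False
    then show ?thesis using col[of i k 0] row[of 0 k 1] ik by simp
  qed
  then show ?thesis using nz[OF ik] by (simp add: \<rho>_def field_simps)
qed

text \<open>The positions of the bars that result from \<open>q0\<close> and the half-angle tangents \<open>t\<close>: first the bars
  \<open>h\<^sub>1, h\<^sub>2, h\<^sub>3\<close>, then \<open>g\<^sub>1, g\<^sub>2, g\<^sub>3\<close>, and finally \<open>h\<^sub>0\<close>.\<close>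

definition place_g :: "real^3^3 \<Rightarrow> (4 \<Rightarrow> 4 \<Rightarrow> real) \<Rightarrow> 4 \<Rightarrow> real^3^3" where
  "place_g q0 t i = (if i = 0 then q0 else
     let k = (if i = 1 then 2 else 1) in q0 ** turn (t 0 k * joint 0 k) ** turn (- (t i k * joint i k)))"

definition place_h :: "real^3^3 \<Rightarrow> (4 \<Rightarrow> 4 \<Rightarrow> real) \<Rightarrow> 4 \<Rightarrow> real^3^3" where
  "place_h q0 t k = (if k = 0 then place_g q0 t 1 ** turn (t 1 0 * joint 1 0) else q0 ** turn (t 0 k * joint 0 k))"

section \<open>Reconstruction of the bars from one bar and the tangents\<close>

lemma linked_unique:
  assumes "linked q p t"
  shows "q i = place_g (q 0) t i" "p k = place_h (q 0) t k"
proof -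
  have inv: "q i = p k ** turn (- (t i k * joint i k))" if "i \<noteq> k" for i k
  proof -
    have "p k = q i ** turn (t i k * joint i k)" using assms that by (simp add: linked_def)
    then show ?thesis by (simp add: matrix_mul_assoc[symmetric] turn_inverse)
  qed
  have p: "p k = q 0 ** turn (t 0 k * joint 0 k)" if "k \<noteq> 0" for k
    using assms that by (simp add: linked_def)
  show q: "q i = place_g (q 0) t i" for i
  proof (cases "i = 0")
    case False
    \<comment> \<open>The bar through which \<open>place_g\<close> reaches \<open>g\<^sub>i\<close>;
      as \<open>g\<^sub>1\<close> and \<open>h\<^sub>1\<close> have no common joint,
      \<open>h\<^sub>2\<close> is taken for \<open>i = 1\<close>.\<close>
    define k where "k = (if i = 1 then 2 else 1 :: 4)"
    have "k \<noteq> 0" "i \<noteq> k" using False by (auto simp: k_def)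
    then show ?thesis using inv[of i k] p[of k] False by (simp add: place_g_def k_def Let_def)
  qed (simp add: place_g_def)
  have "p 0 = q 1 ** turn (t 1 0 * joint 1 0)" using assms by (simp add: linked_def)
  then show "p k = place_h (q 0) t k"
    using p[of k] q[of 1] by (simp add: place_h_def)
qed

text \<open>Seven of the twelve joints hold by construction. Each of the other five is the fourth
  joint of an isogram whose remaining three are already linked, and the closure equations provide
  it.\<close>

lemma linked_place:
  assumes "closed_up t"
  shows "linked (place_g q0 t) (place_h q0 t) t"
proof -
  let ?q = "place_g q0 t" and ?p = "place_h q0 t"
  have step: "?p k = ?q i ** turn (t i k * joint i k)"
    if ijkl: "{j, i, l, k} = {0, 1, 2, 3}" and j: "?p k = ?q j ** turn (t j k * joint j k)"
      and l: "?p l = ?q j ** turn (t j l * joint j l)" "?p l = ?q i ** turn (t i l * joint i l)" for i j k l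
  proof -
    have "?q i = ?p l ** turn (- (t i l * joint i l))"
      unfolding l(2) by (simp add: matrix_mul_assoc[symmetric] turn_inverse)
    also have "\<dots> = ?q j ** (turn (t j l * joint j l) ** turn (- (t i l * joint i l)))"
      unfolding l(1) by (simp add: matrix_mul_assoc)
    also have "\<dots> = ?q j ** (turn (t j k * joint j k) ** turn (- (t i k * joint i k)))"
      using closed_up_turn[OF assms ijkl] by simp
    also have "\<dots> = ?p k ** turn (- (t i k * joint i k))"
      unfolding j by (simp add: matrix_mul_assoc)
    finally show ?thesis by (simp add: matrix_mul_assoc[symmetric] turn_inverse')
  qed
  have q0: "?p k = ?q 0 ** turn (t 0 k * joint 0 k)" if "k \<noteq> 0" for k
    using that by (simp add: place_g_def place_h_def)
  have 12: "?p 2 = ?q 1 ** turn (t 1 2 * joint 1 2)"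
    and 21: "?p 1 = ?q 2 ** turn (t 2 1 * joint 2 1)"
    and 31: "?p 1 = ?q 3 ** turn (t 3 1 * joint 3 1)"
    by (simp_all add: place_g_def place_h_def Let_def matrix_mul_assoc[symmetric] turn_inverse')
  have 10: "?p 0 = ?q 1 ** turn (t 1 0 * joint 1 0)"
    by (simp add: place_h_def)
  have 13: "?p 3 = ?q 1 ** turn (t 1 3 * joint 1 3)"
    by (rule step[OF _ q0 q0 12]) auto
  have 23: "?p 3 = ?q 2 ** turn (t 2 3 * joint 2 3)"
    by (rule step[OF _ q0 q0 21]) auto
  have 32: "?p 2 = ?q 3 ** turn (t 3 2 * joint 3 2)"
    by (rule step[OF _ q0 q0 31]) auto
  have 20: "?p 0 = ?q 2 ** turn (t 2 0 * joint 2 0)"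
    by (rule step[OF _ 10 13 23]) auto
  have 30: "?p 0 = ?q 3 ** turn (t 3 0 * joint 3 0)"
    by (rule step[OF _ 10 12 32]) auto
  show ?thesis
    unfolding linked_def all_4_iff using q0 12 21 31 10 13 23 32 20 30 by simp
qed

lemma rotation_place:
  assumes "rotation_matrix q0"
  shows "rotation_matrix (place_g q0 t i)" "rotation_matrix (place_h q0 t k)"
proof -
  have m: "rotation_matrix (A ** turn z)" if "rotation_matrix A" for A z
    using that rotation_turn[of z] by (simp add: rotation_matrix_def orthogonal_matrix_mul det_mul)
  show g: "rotation_matrix (place_g q0 t i)" for i
    using assms by (simp add: place_g_def Let_def m)
  show "rotation_matrix (place_h q0 t k)"
    using assms by (simp add: place_h_def g m)
qed

end

section \<open>Alignment of coherently directed bars\<close>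

text \<open>For points of the great circle oriented by \<open>c\<close>, this is the unit number
  whose argument is the directed angle from \<open>x\<close> to \<open>y\<close>, so arcs compose by
  multiplication.\<close>

definition dirarc :: "real^3 \<Rightarrow> real^3 \<Rightarrow> real^3 \<Rightarrow> complex" where
  "dirarc c x y = Complex (x \<bullet> y) (c \<bullet> cross3 x y)"

lemma (in planar_frame) dirarc_coord: "dirarc N e y = coord y"
proof -
  have "N \<bullet> cross3 e y = cross3 N e \<bullet> y" by (simp add: cross3_simps)
  then show ?thesis by (simp add: dirarc_def coord_def)
qed

lemma (in planar_frame) cross3_N_emb: "cross3 N (emb w) = emb (\<i> * w)"
  by (simp add: emb_def cross_add_right cross_mult_right cross3_frame)

lemma planar_frame_great_circle: "norm c = 1 \<Longrightarrow> x \<in> great_circle c \<Longrightarrow> planar_frame c x"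
  by (simp add: planar_frame_def great_circle_def)

lemma dirarc_self: "x \<in> great_circle c \<Longrightarrow> dirarc c x x = 1"
  by (simp add: dirarc_def great_circle_def complex_eq_iff norm_eq_1)

lemma cmod_dirarc:
  assumes "norm c = 1" "x \<in> great_circle c" "y \<in> great_circle c"
  shows "cmod (dirarc c x y) = 1"
proof -
  interpret planar_frame c x by (rule planar_frame_great_circle) fact+
  show ?thesis
    using assms(3) norm_emb[of "coord y"] emb_coord[of y] by (simp add: dirarc_coord great_circle_def)
qed

text \<open>In the frame of \<open>c\<close> and \<open>x\<close>, the arc from \<open>y\<close> to
  \<open>z\<close> is the quotient of the coordinates of \<open>z\<close> and
  \<open>y\<close>.\<close>

lemma dirarc_trans:
  assumes "norm c = 1" "x \<in> great_circle c" "y \<in> great_circle c" "z \<in> great_circle c"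
  shows "dirarc c x y * dirarc c y z = dirarc c x z"
proof -
  interpret planar_frame c x by (rule planar_frame_great_circle) fact+
  have y: "emb (coord y) = y" "c \<bullet> y = 0" and z: "c \<bullet> z = 0"
    using assms emb_coord by (simp_all add: great_circle_def)
  have u: "coord y * cnj (coord y) = 1"
    using cmod_dirarc[OF assms(1-3)] unit_mult_cnj by (simp add: dirarc_coord)
  have "c \<bullet> cross3 y z = cross3 c y \<bullet> z" by (simp add: cross3_simps)
  also have "cross3 c y = emb (\<i> * coord y)" using cross3_N_emb y(1) by metis
  finally have "dirarc c y z = cnj (coord y) * coord z"
    using y z by (simp add: dirarc_def inner_coord[of y z] inner_coord[of "emb _" z] complex_eq_iff)
  then have "coord y * dirarc c y z = (coord y * cnj (coord y)) * coord z" by simp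
  then show ?thesis unfolding u by (simp add: dirarc_coord)
qed

lemma rotation_to_equator:
  assumes A: "rotation_matrix A" "A *v c = pole" "A *v x = equator w"
    and c: "norm c = 1" "x \<in> great_circle c" "y \<in> great_circle c"
  shows "A *v y = equator (w * dirarc c x y)"
proof -
  interpret planar_frame c x by (rule planar_frame_great_circle) fact+
  have y: "emb (coord y) = y" using c(3) emb_coord by (simp add: great_circle_def)
  have "A *v cross3 c x = equator (\<i> * w)"
    using cross_rotation_matrix[OF A(1), of c x] A(2,3) by (simp add: cross3_pole_equator)
  then have "A *v emb (coord y) = Re (coord y) *\<^sub>R equator w + Im (coord y) *\<^sub>R equator (\<i> * w)"
    by (simp add: emb_def matrix_vector_right_distrib matrix_vector_mult_scaleR A)
  also have "\<dots> = equator (w * coord y)"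
    by (simp add: vec_eq_iff forall_3 algebra_simps)
  finally show ?thesis by (simp add: y dirarc_coord)
qed

text \<open>By coherence an arc is the same on both bars that carry its ends, so all arcs are
  quotients of values of one function, normalized to 1 at position 1.\<close>

lemma arc_potential:
  fixes D :: "4 \<Rightarrow> 4 \<Rightarrow> 4 \<Rightarrow> complex"
  assumes unit: "\<And>i k l. i \<noteq> k \<Longrightarrow> i \<noteq> l \<Longrightarrow> cmod (D i k l) = 1"
    and refl: "\<And>i k. i \<noteq> k \<Longrightarrow> D i k k = 1"
    and trans: "\<And>i k l m. i \<noteq> k \<Longrightarrow> i \<noteq> l \<Longrightarrow> i \<noteq> m \<Longrightarrow> D i k l * D i l m = D i k m"
    and coherent: "\<And>i j k l. {i, j, k, l} = {0, 1, 2, 3} \<Longrightarrow> D i k l = D j k l"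
  obtains S where "\<And>k. cmod (S k) = 1" "\<And>i k l. i \<noteq> k \<Longrightarrow> i \<noteq> l \<Longrightarrow> S l = S k * D i k l"
proof -
  \<comment> \<open>Values are arcs measured from position 1 on bar 0. That bar has no position 0,
    so the value there is taken from bar 2.\<close>
  define S where "S k = (if k = 0 then D 2 1 0 else D 0 1 k)" for k
  have co: "D 2 1 3 = D 0 1 3" "D 3 1 2 = D 0 1 2" "D 3 1 0 = D 2 1 0" "D 1 2 3 = D 0 2 3" "D 1 2 0 = D 3 2 0"
    by (rule coherent; auto)+
  \<comment> \<open>For each bar it suffices to measure from one base position; bar 1 lacks position
    1 and uses 2.\<close>
  have base: "\<exists>b. b \<noteq> i \<and> (\<forall>l. l \<noteq> i \<longrightarrow> S l = S b * D i b l)" for i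
  proof -
    have 0: "\<forall>l. l \<noteq> 0 \<longrightarrow> S l = S 1 * D 0 1 l"
      by (simp add: S_def refl)
    have 2: "\<forall>l. l \<noteq> 2 \<longrightarrow> S l = S 1 * D 2 1 l"
      unfolding all_4_iff by (simp add: S_def refl co)
    have 3: "\<forall>l. l \<noteq> 3 \<longrightarrow> S l = S 1 * D 3 1 l"
      unfolding all_4_iff by (simp add: S_def refl co)
    have "S 3 = S 2 * D 1 2 3"
      using trans[of 0 1 2 3] by (simp add: S_def co)
    moreover have "S 0 = S 2 * D 1 2 0"
      using trans[of 3 1 2 0] by (simp add: S_def co)
    ultimately have 1: "\<forall>l. l \<noteq> 1 \<longrightarrow> S l = S 2 * D 1 2 l"
      unfolding all_4_iff by (simp add: refl)
    have "i = 0 \<or> i = 1 \<or> i = 2 \<or> i = 3"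
      using all_4_iff[of "\<lambda>i. i = 0 \<or> i = 1 \<or> i = 2 \<or> i = 3"] by simp
    then show ?thesis
    proof (elim disjE)
      show ?thesis if "i = 0" unfolding that by (intro exI[of _ 1] conjI, simp, rule 0)
      show ?thesis if "i = 1" unfolding that by (intro exI[of _ 2] conjI, simp, rule 1)
      show ?thesis if "i = 2" unfolding that by (intro exI[of _ 1] conjI, simp, rule 2)
      show ?thesis if "i = 3" unfolding that by (intro exI[of _ 1] conjI, simp, rule 3)
    qed
  qed
  have "cmod (S k) = 1" for k
    by (cases "k = 0"; cases "k = 1") (simp_all add: S_def unit refl)
  moreover have "S l = S k * D i k l" if ne: "i \<noteq> k" "i \<noteq> l" for i k l
  proof -
    obtain b where b: "b \<noteq> i" "S k = S b * D i b k" "S l = S b * D i b l"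
      using base[of i] ne by metis
    have "D i b k * D i k l = D i b l" by (rule trans) (use b ne in auto)
    then show ?thesis using b by (simp add: mult.assoc)
  qed
  ultimately show thesis using that by blast
qed

text \<open>The arcs on the bars \<open>a i\<close> yield \<open>S\<close>, those on the bars
  \<open>b k\<close> yield \<open>T\<close>. Once one joint of a bar is at its place
  \<open>T i * S k\<close> on the equator, the other two follow, because their arcs from it are
  quotients of values of \<open>S\<close> or of \<open>T\<close>.\<close>

lemma aligned_frame:
  fixes a b :: "4 \<Rightarrow> real^3" and J :: "4 \<Rightarrow> 4 \<Rightarrow> real^3"
  assumes unit: "\<And>i. norm (a i) = 1" "\<And>k. norm (b k) = 1"
    and J: "\<And>i k. i \<noteq> k \<Longrightarrow> J i k \<in> great_circle (a i)" "\<And>i k. i \<noteq> k \<Longrightarrow> J i k \<in> great_circle (b k)"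
    and len: "\<And>i j k l. {i, j, k, l} = {0, 1, 2, 3} \<Longrightarrow> J i k \<bullet> J i l = J j k \<bullet> J j l"
      "\<And>i j k l. {i, j, k, l} = {0, 1, 2, 3} \<Longrightarrow> J i l \<bullet> J j l = J i k \<bullet> J j k"
    and dir: "\<And>i j k l. {i, j, k, l} = {0, 1, 2, 3} \<Longrightarrow> a i \<bullet> cross3 (J i k) (J i l) = a j \<bullet> cross3 (J j k) (J j l)"
      "\<And>i j k l. {i, j, k, l} = {0, 1, 2, 3} \<Longrightarrow> b l \<bullet> cross3 (J i l) (J j l) = b k \<bullet> cross3 (J i k) (J j k)"
    and nondeg: "\<And>i j k l. {i, j, k, l} = {0, 1, 2, 3} \<Longrightarrow> (J i k \<bullet> J i l)\<^sup>2 \<noteq> 1"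
      "\<And>i j k l. {i, j, k, l} = {0, 1, 2, 3} \<Longrightarrow> (J i k \<bullet> J j k)\<^sup>2 \<noteq> 1"
  obtains T S \<alpha> \<beta> where "aligned_linkage T S" "\<And>i. rotation_matrix (\<alpha> i)" "\<And>k. rotation_matrix (\<beta> k)"
    "\<And>i. \<alpha> i *v a i = pole" "\<And>k. \<beta> k *v b k = pole"
    "\<And>i k. i \<noteq> k \<Longrightarrow> \<alpha> i *v J i k = equator (T i * S k)"
    "\<And>i k. i \<noteq> k \<Longrightarrow> \<beta> k *v J i k = equator (T i * S k)"
proof -
  define D where "D i k l = dirarc (a i) (J i k) (J i l)" for i k l
  define B where "B k i j = dirarc (b k) (J i k) (J j k)" for k i j
  obtain S where S: "\<And>k. cmod (S k) = 1" "\<And>i k l. i \<noteq> k \<Longrightarrow> i \<noteq> l \<Longrightarrow> S l = S k * D i k l"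
  proof (rule arc_potential[of D])
    show "D i k l = D j k l" if "{i, j, k, l} = {0, 1, 2, 3}" for i j k l
      using len(1)[OF that] dir(1)[OF that] by (simp add: D_def dirarc_def)
  qed (auto simp: D_def cmod_dirarc dirarc_self dirarc_trans J unit)
  obtain T where T: "\<And>i. cmod (T i) = 1" "\<And>k i j. k \<noteq> i \<Longrightarrow> k \<noteq> j \<Longrightarrow> T j = T i * B k i j"
  proof (rule arc_potential[of B])
    show "B l i j = B k i j" if "{l, k, i, j} = {0, 1, 2, 3}" for i j k l
    proof -
      have "{i, j, k, l} = {0, 1, 2, 3}" using that by (auto simp: insert_commute)
      then show ?thesis using len(2) dir(2) by (simp add: B_def dirarc_def)
    qed
  qed (auto simp: B_def cmod_dirarc dirarc_self dirarc_trans J unit)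
  have sq: "x\<^sup>2 \<noteq> y\<^sup>2" if "y = x * d" "(Re d)\<^sup>2 \<noteq> 1" "cmod x = 1" for x y d :: complex
  proof
    assume "x\<^sup>2 = y\<^sup>2"
    then have "x\<^sup>2 * d\<^sup>2 = x\<^sup>2 * 1" using that by (simp add: power_mult_distrib)
    moreover have "x\<^sup>2 \<noteq> 0" using that(3) by auto
    ultimately have "d\<^sup>2 = 1" using mult_cancel_left by blast
    then have "d = 1 \<or> d = - 1" by (simp add: power2_eq_1_iff)
    then show False using that(2) by auto
  qed
  have "aligned_linkage T S"
  proof
    show "(T i)\<^sup>2 \<noteq> (T j)\<^sup>2" if ne: "i \<noteq> j" for i j
    proof -
      \<comment> \<open>Any index other than \<open>i\<close> and \<open>j\<close> serves: on
        \<open>b m\<close> the joints of \<open>i\<close> and \<open>j\<close> bound a side, so the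
        arc between them is not 1 or -1.\<close>
      define m :: 4 where "m = (if 0 \<noteq> i \<and> 0 \<noteq> j then 0 else if 1 \<noteq> i \<and> 1 \<noteq> j then 1 else 2)"
      have m: "i \<noteq> m" "j \<noteq> m" using ne by (auto simp: m_def split: if_splits)
      obtain l where "{i, l, j, m} = {0, 1, 2, 3}" by (rule ex_fourth_index[OF ne m])
      then have "{i, j, m, l} = {0, 1, 2, 3}" by (auto simp: insert_commute)
      then have "(Re (B m i j))\<^sup>2 \<noteq> 1" using nondeg(2) by (simp add: B_def dirarc_def)
      then show ?thesis using T m by (intro sq) auto
    qed
    show "(S i)\<^sup>2 \<noteq> (S j)\<^sup>2" if ne: "i \<noteq> j" for i j
    proof -
      define m :: 4 where "m = (if 0 \<noteq> i \<and> 0 \<noteq> j then 0 else if 1 \<noteq> i \<and> 1 \<noteq> j then 1 else 2)"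
      have m: "i \<noteq> m" "j \<noteq> m" using ne by (auto simp: m_def split: if_splits)
      obtain l where "{i, l, j, m} = {0, 1, 2, 3}" by (rule ex_fourth_index[OF ne m])
      then have "{m, l, i, j} = {0, 1, 2, 3}" by (auto simp: insert_commute)
      then have "(Re (D m i j))\<^sup>2 \<noteq> 1" using nondeg(1) by (simp add: D_def dirarc_def)
      then show ?thesis using S m by (intro sq) auto
    qed
  qed (fact T(1) S(1))+
  moreover have "\<exists>\<alpha>. \<forall>i. rotation_matrix (\<alpha> i) \<and> \<alpha> i *v a i = pole \<and>
      (\<forall>k. i \<noteq> k \<longrightarrow> \<alpha> i *v J i k = equator (T i * S k))"
  proof (rule choice, rule allI)
    fix i :: 4
    define k :: 4 where "k = (if i = 0 then 1 else 0)"
    have k: "i \<noteq> k" by (simp add: k_def)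
    obtain A where A: "rotation_matrix A" "A *v a i = pole" "A *v J i k = equator (T i * S k)"
      using orthonormal_pair_rotation[of "a i" "J i k" pole "equator (T i * S k)"] unit J(1)[OF k] S(1) T(1)
      by (auto simp: great_circle_def norm_mult)
    have "A *v J i l = equator (T i * S l)" if "i \<noteq> l" for l
      using rotation_to_equator[OF A unit(1) J(1)[OF k] J(1)[OF that]] S(2)[OF k that]
      by (simp add: D_def mult.assoc)
    with A show "\<exists>A. rotation_matrix A \<and> A *v a i = pole \<and> (\<forall>k. i \<noteq> k \<longrightarrow> A *v J i k = equator (T i * S k))"
      by blast
  qed
  moreover have "\<exists>\<beta>. \<forall>k. rotation_matrix (\<beta> k) \<and> \<beta> k *v b k = pole \<and>
      (\<forall>i. i \<noteq> k \<longrightarrow> \<beta> k *v J i k = equator (T i * S k))"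
  proof (rule choice, rule allI)
    fix k :: 4
    define i :: 4 where "i = (if k = 0 then 1 else 0)"
    have i: "i \<noteq> k" by (simp add: i_def)
    obtain A where A: "rotation_matrix A" "A *v b k = pole" "A *v J i k = equator (T i * S k)"
      using orthonormal_pair_rotation[of "b k" "J i k" pole "equator (T i * S k)"] unit J(2)[OF i] S(1) T(1)
      by (auto simp: great_circle_def norm_mult)
    have "A *v J j k = equator (T j * S k)" if "j \<noteq> k" for j
      using rotation_to_equator[OF A unit(2) J(2)[OF i] J(2)[OF that]] T(2)[of k i j] i that
      by (simp add: B_def ac_simps)
    with A show "\<exists>A. rotation_matrix A \<and> A *v b k = pole \<and> (\<forall>i. i \<noteq> k \<longrightarrow> A *v J i k = equator (T i * S k))"
      by blast
  qed
  ultimately show thesis using that by metis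
qed

section \<open>Flexibility\<close>

lemma continuous_on_matrixI:
  fixes f :: "'a::topological_space \<Rightarrow> real^'n^'m"
  assumes "\<And>i j. continuous_on A (\<lambda>x. f x $ i $ j)"
  shows "continuous_on A f"
proof -
  have "continuous_on A (\<lambda>x. \<chi> i j. f x $ i $ j)"
    by (intro continuous_on_vec_lambda assms)
  then show ?thesis by simp
qed

lemma continuous_on_matrix_mult:
  fixes f :: "'a::topological_space \<Rightarrow> real^'n^'m" and g :: "'a \<Rightarrow> real^'k^'n"
  assumes "continuous_on A f" "continuous_on A g"
  shows "continuous_on A (\<lambda>x. f x ** g x)"
  by (rule continuous_on_matrixI)
    (auto simp: matrix_matrix_mult_def intro!: continuous_intros continuous_on_component assms)

lemma continuous_on_transpose:
  fixes f :: "'a::topological_space \<Rightarrow> real^'n^'m"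
  assumes "continuous_on A f"
  shows "continuous_on A (\<lambda>x. transpose (f x))"
  by (rule continuous_on_matrixI)
    (auto simp: transpose_def intro!: continuous_on_component assms)

lemma continuous_on_turn:
  assumes "continuous_on A f"
  shows "continuous_on A (\<lambda>x. turn (f x))"
proof -
  have nz: "qnorm 1 (f x) \<noteq> 0" for x using qnorm_pos[of 1 "f x"] by simp
  have n: "continuous_on A (\<lambda>x. qnorm 1 (f x))"
    unfolding qnorm_def by (intro continuous_intros assms)
  have "\<forall>i j. continuous_on A (\<lambda>x. turn (f x) $ i $ j)"
    unfolding forall_3 quat_components qmat_components
    by (intro conjI continuous_on_divide n ballI nz) (intro continuous_intros assms)+
  then show ?thesis by (intro continuous_on_matrixI) blast
qed

text \<open>The cosine in terms of the half-angle tangent; \<open>turn_col3\<close> is the companion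
  for the sine.\<close>

lemma turn_33: "cmod w = 1 \<Longrightarrow> turn (of_real t * w) $ 3 $ 3 = (1 - t\<^sup>2) / (1 + t\<^sup>2)"
proof -
  assume w: "cmod w = 1"
  have "qnorm 1 (of_real t * w) = 1 + t\<^sup>2" using w by (simp add: qnorm_def norm_mult)
  moreover have "(t * Re w)\<^sup>2 + (t * Im w)\<^sup>2 = t\<^sup>2"
    using w cmod_power2[of w] by (simp add: power_mult_distrib flip: distrib_left)
  ultimately show ?thesis by (simp add: quat_components qmat_components)
qed

lemma turn_col3:
  assumes "cmod w = 1"
  shows "Re (cnj w * Complex (- turn (of_real t * w) $ 2 $ 3) (turn (of_real t * w) $ 1 $ 3)) = 2 * t / (1 + t\<^sup>2)"
proof -
  let ?n = "1 + t\<^sup>2"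
  have "qnorm 1 (of_real t * w) = ?n" using assms by (simp add: qnorm_def norm_mult)
  then have e: "turn (of_real t * w) $ 2 $ 3 = - (2 * t * Re w / ?n)" "turn (of_real t * w) $ 1 $ 3 = 2 * t * Im w / ?n"
    unfolding quat_components qmat_components by simp_all
  have "Re (cnj w * Complex (2 * t * Re w / ?n) (2 * t * Im w / ?n)) = 2 * t * ((Re w)\<^sup>2 + (Im w)\<^sup>2) / ?n"
    by (simp add: power2_eq_square distrib_left add_divide_distrib ac_simps)
  then show ?thesis unfolding e using assms cmod_power2[of w] by simp
qed

section \<open>Poses described by half-angle tangents at the joints\<close>

locale aligned_bars = aligned_linkage +
  fixes \<alpha> \<beta> :: "4 \<Rightarrow> real^3^3" and J :: "4 \<Rightarrow> 4 \<Rightarrow> real^3"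
  assumes rot_\<alpha>: "rotation_matrix (\<alpha> i)" and rot_\<beta>: "rotation_matrix (\<beta> k)"
    and \<alpha>_J: "i \<noteq> k \<Longrightarrow> \<alpha> i *v J i k = equator (joint i k)"
    and \<beta>_J: "i \<noteq> k \<Longrightarrow> \<beta> k *v J i k = equator (joint i k)"
begin

text \<open>Bars are measured from their model on the equator instead of the reference placement, so
  that the relative rotation at a joint fixes a point of the equator.\<close>

definition bar_g :: "pose \<Rightarrow> 4 \<Rightarrow> real^3^3" where "bar_g Q i = fst Q $ i ** transpose (\<alpha> i)"
definition bar_h :: "pose \<Rightarrow> 4 \<Rightarrow> real^3^3" where "bar_h Q k = snd Q $ k ** transpose (\<beta> k)"
definition rel :: "pose \<Rightarrow> 4 \<Rightarrow> 4 \<Rightarrow> real^3^3" where "rel Q i k = transpose (bar_g Q i) ** bar_h Q k"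

definition sin_at :: "pose \<Rightarrow> 4 \<Rightarrow> 4 \<Rightarrow> real" where
  "sin_at Q i k = Re (cnj (joint i k) * Complex (- rel Q i k $ 2 $ 3) (rel Q i k $ 1 $ 3))"

definition tan_half_at :: "pose \<Rightarrow> 4 \<Rightarrow> 4 \<Rightarrow> real" where
  "tan_half_at Q i k = sin_at Q i k / (1 + rel Q i k $ 3 $ 3)"

definition placed :: "real^3^3 \<Rightarrow> (4 \<Rightarrow> 4 \<Rightarrow> real) \<Rightarrow> pose" where
  "placed q0 t = (\<chi> i. place_g q0 t i ** \<alpha> i, \<chi> k. place_h q0 t k ** \<beta> k)"

lemma rot_inverse: "rotation_matrix A \<Longrightarrow> A ** transpose A = mat 1" "rotation_matrix A \<Longrightarrow> transpose A ** A = mat 1"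
  for A :: "real^3^3"
  by (simp_all add: rotation_matrix_def orthogonal_matrix_def)

lemma rot_mult: "rotation_matrix A \<Longrightarrow> rotation_matrix B \<Longrightarrow> rotation_matrix (A ** B)"
  and rot_transpose: "rotation_matrix A \<Longrightarrow> rotation_matrix (transpose A)" for A B :: "real^3^3"
  by (simp_all add: rotation_matrix_def orthogonal_matrix_mul det_mul orthogonal_matrix_transpose)

lemma \<alpha>_inv: "i \<noteq> k \<Longrightarrow> transpose (\<alpha> i) *v equator (joint i k) = J i k"
  and \<beta>_inv: "i \<noteq> k \<Longrightarrow> transpose (\<beta> k) *v equator (joint i k) = J i k"
  using rot_inverse(2)[OF rot_\<alpha>] rot_inverse(2)[OF rot_\<beta>] \<alpha>_J \<beta>_J
  by (metis matrix_vector_mul_assoc matrix_vector_mul_lid)+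

context
  fixes Q assumes Q: "Q \<in> poses J"
begin

lemma rot_bars: "rotation_matrix (bar_g Q i)" "rotation_matrix (bar_h Q k)" "rotation_matrix (rel Q i k)"
  using Q rot_\<alpha> rot_\<beta> by (auto simp: poses_def bar_g_def bar_h_def rel_def intro!: rot_mult rot_transpose)

lemma rel_fixes_joint:
  assumes "i \<noteq> k"
  shows "rel Q i k *v equator (joint i k) = equator (joint i k)"
proof -
  have "bar_g Q i *v equator (joint i k) = bar_h Q k *v equator (joint i k)"
    using Q assms \<alpha>_inv[OF assms] \<beta>_inv[OF assms]
    by (auto simp: poses_def bar_g_def bar_h_def simp flip: matrix_vector_mul_assoc)
  then have "rel Q i k *v equator (joint i k) = (transpose (bar_g Q i) ** bar_g Q i) *v equator (joint i k)"
    unfolding rel_def by (simp only: matrix_vector_mul_assoc[symmetric])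
  then show ?thesis using rot_inverse(2)[OF rot_bars(1)] by simp
qed

lemma sin_cos_at: "i \<noteq> k \<Longrightarrow> (sin_at Q i k)\<^sup>2 + (rel Q i k $ 3 $ 3)\<^sup>2 = 1"
  unfolding sin_at_def
  by (rule rotation_fixing_equator_column(3)[OF rot_bars(3) rel_fixes_joint unit_joint])

lemma cos_at_pos: "i \<noteq> k \<Longrightarrow> sin_at Q i k \<noteq> 0 \<Longrightarrow> 0 < 1 + rel Q i k $ 3 $ 3"
proof -
  assume ik: "i \<noteq> k" and s: "sin_at Q i k \<noteq> 0"
  have "0 < (sin_at Q i k)\<^sup>2" using s by simp
  then have "(rel Q i k $ 3 $ 3)\<^sup>2 < 1" using sin_cos_at[OF ik] by linarith
  then have "\<bar>rel Q i k $ 3 $ 3\<bar> < 1" by (simp add: abs_square_less_1)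
  then show ?thesis by simp
qed

lemma linked_bars:
  assumes s: "\<And>i k. i \<noteq> k \<Longrightarrow> sin_at Q i k \<noteq> 0"
  shows "linked (bar_g Q) (bar_h Q) (tan_half_at Q)"
  unfolding linked_def
proof (intro allI impI)
  fix i k :: 4 assume ik: "i \<noteq> k"
  have "rel Q i k $ 3 $ 3 \<noteq> - 1" using cos_at_pos[OF ik s[OF ik]] by simp
  from rotation_fixing_equator[OF rot_bars(3) rel_fixes_joint[OF ik] unit_joint this]
  have "rel Q i k = turn (tan_half_at Q i k * joint i k)"
    by (simp only: tan_half_at_def sin_at_def)
  moreover have "bar_g Q i ** rel Q i k = bar_h Q k"
    unfolding rel_def using rot_inverse(1)[OF rot_bars(1)[of i]] by (simp add: matrix_mul_assoc)
  ultimately show "bar_h Q k = bar_g Q i ** turn (tan_half_at Q i k * joint i k)" by simp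
qed

text \<open>A linked family is determined by its first bar and the tangents. This shows later that
  the motion reaches every nearby pose.\<close>

lemma placed_bars:
  assumes "\<And>i k. i \<noteq> k \<Longrightarrow> sin_at Q i k \<noteq> 0"
  shows "placed (bar_g Q 0) (tan_half_at Q) = Q"
proof -
  have "bar_g Q i ** \<alpha> i = fst Q $ i" "bar_h Q k ** \<beta> k = snd Q $ k" for i k
    using rot_inverse(2)[OF rot_\<alpha>[of i]] rot_inverse(2)[OF rot_\<beta>[of k]]
    by (simp_all add: bar_g_def bar_h_def matrix_mul_assoc[symmetric])
  moreover have place: "place_g (bar_g Q 0) (tan_half_at Q) i = bar_g Q i"
      "place_h (bar_g Q 0) (tan_half_at Q) k = bar_h Q k" for i k
    by (rule linked_unique[OF linked_bars[OF assms], symmetric]; assumption)+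
  ultimately show ?thesis
    by (simp add: placed_def place prod_eq_iff vec_eq_iff)
qed

end

text \<open>The construction reads tangents only at pairs of different indices, and only there are
  two solutions known to be proportional.\<close>

lemma placed_cong:
  assumes "\<And>i k. i \<noteq> k \<Longrightarrow> t i k = t' i k"
  shows "placed q0 t = placed q0 t'"
proof -
  have g: "place_g q0 t i = place_g q0 t' i" for i
    unfolding place_g_def Let_def using assms[of 0 1] assms[of 0 2] assms[of i 1] assms[of i 2] by auto
  have "place_h q0 t k = place_h q0 t' k" for k
    unfolding place_h_def using assms[of 0 k] assms[of 1 0] g[of 1] by auto
  with g show ?thesis by (simp add: placed_def)
qed

context
  fixes q0 :: "real^3^3" and t assumes q0: "rotation_matrix q0" and t: "closed_up t"
begin

lemma bars_placed: "bar_g (placed q0 t) i = place_g q0 t i" "bar_h (placed q0 t) k = place_h q0 t k"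
  using rot_inverse(1)[OF rot_\<alpha>[of i]] rot_inverse(1)[OF rot_\<beta>[of k]]
  by (simp_all add: bar_g_def bar_h_def placed_def matrix_mul_assoc[symmetric])

lemma rel_placed: "i \<noteq> k \<Longrightarrow> rel (placed q0 t) i k = turn (t i k * joint i k)"
  using linked_place[OF t, of q0] rot_inverse(2)[OF rotation_place(1)[OF q0, of t i]]
  by (simp add: rel_def bars_placed linked_def matrix_mul_assoc)

lemma placed_pose: "placed q0 t \<in> poses J"
proof -
  have "(place_g q0 t i ** \<alpha> i) *v J i k = (place_h q0 t k ** \<beta> k) *v J i k" if "i \<noteq> k" for i k
  proof -
    have "place_h q0 t k = place_g q0 t i ** turn (t i k * joint i k)"
      using linked_place[OF t, of q0] that by (simp add: linked_def)
    then show ?thesis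
      using \<alpha>_J[OF that] \<beta>_J[OF that] by (simp add: turn_equator flip: matrix_vector_mul_assoc)
  qed
  then show ?thesis
    using rot_mult[OF rotation_place(1)[OF q0] rot_\<alpha>] rot_mult[OF rotation_place(2)[OF q0] rot_\<beta>]
    by (simp add: poses_def placed_def)
qed

lemma sin_at_placed:
  assumes ik: "i \<noteq> k"
  shows "sin_at (placed q0 t) i k = 2 * t i k / (1 + (t i k)\<^sup>2)"
  unfolding sin_at_def rel_placed[OF ik] by (rule turn_col3[OF unit_joint])

lemma tan_half_at_placed:
  assumes ik: "i \<noteq> k"
  shows "tan_half_at (placed q0 t) i k = t i k"
proof -
  have "0 < 1 + (t i k)\<^sup>2" by (simp add: add_pos_nonneg)
  moreover from this have "1 + (1 - (t i k)\<^sup>2) / (1 + (t i k)\<^sup>2) = 2 / (1 + (t i k)\<^sup>2)"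
    by (simp add: field_simps)
  ultimately show ?thesis
    unfolding tan_half_at_def sin_at_placed[OF ik] rel_placed[OF ik] turn_33[OF unit_joint] by simp
qed

end

lemma continuous_on_rel:
  "continuous_on A (\<lambda>Q. rel Q i k $ m $ n)"
  unfolding rel_def bar_g_def bar_h_def
  by (intro continuous_on_component continuous_on_matrix_mult continuous_on_transpose continuous_intros)

lemma continuous_on_sin_at: "continuous_on A (\<lambda>Q. sin_at Q i k)"
proof -
  have "sin_at Q i k = Im (joint i k) * rel Q i k $ 1 $ 3 - Re (joint i k) * rel Q i k $ 2 $ 3" for Q
    by (simp add: sin_at_def algebra_simps)
  then show ?thesis by (simp only:) (intro continuous_intros continuous_on_rel)
qed

lemma continuous_on_placed:
  assumes "\<And>i k. continuous_on A (\<lambda>x. t x i k)"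
  shows "continuous_on A (\<lambda>x. placed q0 (t x))"
proof -
  have tn: "continuous_on A (\<lambda>x. turn (of_real (t x i k) * joint i k))"
    "continuous_on A (\<lambda>x. turn (- (of_real (t x i k) * joint i k)))" for i k
    by (intro continuous_on_turn continuous_intros assms)+
  have g: "continuous_on A (\<lambda>x. place_g q0 (t x) i)" for i
    unfolding place_g_def Let_def
    by (cases "i = 0") (simp_all add: continuous_on_matrix_mult tn)
  have h: "continuous_on A (\<lambda>x. place_h q0 (t x) k)" for k
    unfolding place_h_def
    by (cases "k = 0") (simp_all add: continuous_on_matrix_mult tn g)
  show ?thesis
    unfolding placed_def
    by (intro continuous_on_Pair continuous_on_vec_lambda continuous_on_matrix_mult g h continuous_on_const)
qed

text \<open>Every positive multiple of the tangents of \<open>P\<close> can be placed as a pose, and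
  by \<open>closed_up_proportional\<close> a pose whose sines have the same signs is one of these.
  The multiplier thus parametrizes the nearby relative poses.\<close>

theorem flexible:
  assumes P: "P \<in> poses J" and na: "\<And>i k. i \<noteq> k \<Longrightarrow> sin_at P i k \<noteq> 0"
  shows "flexible_with_one_dof J P"
proof -
  define q0 t where "q0 = bar_g P 0" and "t = tan_half_at P"
  \<comment> \<open>Keeping the signs of all twelve sines is an open condition and excludes the
    relative angles 0 and pi.\<close>
  define U where "U = {Q. \<forall>i k. i \<noteq> k \<longrightarrow> 0 < sin_at Q i k * sin_at P i k}"
  \<comment> \<open>The factor \<open>(1 + x) / (1 - x)\<close> maps the interval from -1 to 1 onto
    the positive reals and 0 to 1; \<open>time\<close> inverts it, reading the factor at the joint
    (0, 1).\<close>
  define move where "move x = placed q0 (\<lambda>i k. (1 + x) / (1 - x) * t i k)" for x :: real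
  define time where "time Q = (tan_half_at Q 0 1 / t 0 1 - 1) / (tan_half_at Q 0 1 / t 0 1 + 1)" for Q
  have q0: "rotation_matrix q0" unfolding q0_def by (rule rot_bars(1)[OF P])
  have link: "linked (bar_g P) (bar_h P) t" unfolding t_def by (rule linked_bars[OF P na])
  have closed: "closed_up t" by (rule linked_closed_up[OF rot_bars(1)[OF P] link])
  have sgn_tan: "0 < tan_half_at Q i k * t i k" if "Q \<in> poses J" "Q \<in> U" "i \<noteq> k" for Q i k
  proof -
    have s: "0 < sin_at Q i k * sin_at P i k" using that by (simp add: U_def)
    then have "sin_at Q i k \<noteq> 0" by auto
    then have "0 < 1 + rel Q i k $ 3 $ 3" "0 < 1 + rel P i k $ 3 $ 3"
      using cos_at_pos that P na by blast+
    then have "0 < (sin_at Q i k * sin_at P i k) / ((1 + rel Q i k $ 3 $ 3) * (1 + rel P i k $ 3 $ 3))"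
      using s by simp
    then show ?thesis by (simp add: tan_half_at_def t_def)
  qed
  have PU: "P \<in> U" using na by (simp add: U_def zero_less_mult_iff linorder_neq_iff[symmetric])
  have t01: "t 0 1 \<noteq> 0" using sgn_tan[OF P PU, of 0 1] by auto
  have "open U"
  proof -
    have "open {Q. i \<noteq> k \<longrightarrow> 0 < sin_at Q i k * sin_at P i k}" for i k
      by (cases "i = k") (simp_all add: open_Collect_less continuous_on_sin_at continuous_on_mult_right)
    then have "open (\<Inter>i\<in>UNIV. \<Inter>k\<in>UNIV. {Q. i \<noteq> k \<longrightarrow> 0 < sin_at Q i k * sin_at P i k})"
      by (intro open_INT finite ballI)
    moreover have "U = (\<Inter>i\<in>UNIV. \<Inter>k\<in>UNIV. {Q. i \<noteq> k \<longrightarrow> 0 < sin_at Q i k * sin_at P i k})"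
      by (auto simp: U_def)
    ultimately show ?thesis by simp
  qed
  have fac: "0 < (1 + x) / (1 - x)" if "x \<in> {-1<..<1}" for x :: real
    using that by simp
  have move_in: "move x \<in> U \<inter> relative_poses J P" and time_move: "time (move x) = x"
    if x: "x \<in> {-1<..<1}" for x
  proof -
    let ?\<mu> = "(1 + x) / (1 - x)"
    have c: "closed_up (\<lambda>i k. ?\<mu> * t i k)" by (rule closed_up_scale[OF closed])
    \<comment> \<open>The sine and the half-angle tangent have the same sign, so a positive factor
      preserves the signs of the sines.\<close>
    have "0 < sin_at (move x) i k * sin_at P i k" if ik: "i \<noteq> k" for i k
    proof -
      have p: "0 < 1 + rel P i k $ 3 $ 3" by (rule cos_at_pos[OF P ik na[OF ik]])
      then have s: "sin_at P i k = (1 + rel P i k $ 3 $ 3) * t i k" by (simp add: t_def tan_half_at_def)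
      have "t i k \<noteq> 0" using na[OF ik] s by auto
      have "2 * (m * y) / d * (c * y) = (2 * m * c / d) * y\<^sup>2" for m y c d :: real
        by (simp add: power2_eq_square)
      then have e: "sin_at (move x) i k * sin_at P i k
          = (2 * ?\<mu> * (1 + rel P i k $ 3 $ 3) / (1 + (?\<mu> * t i k)\<^sup>2)) * (t i k)\<^sup>2"
        unfolding move_def sin_at_placed[OF q0 c ik] s .
      have "0 < 2 * ?\<mu> * (1 + rel P i k $ 3 $ 3) / (1 + (?\<mu> * t i k)\<^sup>2)"
        by (rule divide_pos_pos[OF mult_pos_pos[OF mult_pos_pos[OF zero_less_numeral fac[OF x]] p]])
          (simp add: add_pos_nonneg)
      then show ?thesis unfolding e by (rule mult_pos_pos) (simp add: \<open>t i k \<noteq> 0\<close>)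
    qed
    then have "move x \<in> U" by (simp add: U_def)
    moreover have "move x \<in> poses J" unfolding move_def by (rule placed_pose[OF q0 c])
    moreover have "fst (move x) $ 0 = fst P $ 0"
      using rot_inverse(2)[OF rot_\<alpha>[of 0]]
      by (simp add: move_def placed_def place_g_def q0_def bar_g_def matrix_mul_assoc[symmetric])
    ultimately show "move x \<in> U \<inter> relative_poses J P" by (simp add: relative_poses_def)
    have "tan_half_at (move x) 0 1 / t 0 1 = ?\<mu>"
      using t01 unfolding move_def by (subst tan_half_at_placed[OF q0 c]) auto
    then have "time (move x) = (?\<mu> - 1) / (?\<mu> + 1)" by (simp only: time_def)
    also have "\<dots> = x" using x by (simp add: field_simps)
    finally show "time (move x) = x" .
  qed
  have move_time: "move (time Q) = Q" and time_in: "time Q \<in> {-1<..<1}" if Q: "Q \<in> U \<inter> relative_poses J P" for Q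
  proof -
    have QP: "Q \<in> poses J" "Q \<in> U" and Q0: "bar_g Q 0 = q0"
      using Q by (auto simp: relative_poses_def q0_def bar_g_def)
    have s: "sin_at Q i k \<noteq> 0" if "i \<noteq> k" for i k
    proof -
      have "0 < sin_at Q i k * sin_at P i k" using QP(2) that by (simp add: U_def)
      then show ?thesis by auto
    qed
    have cQ: "closed_up (tan_half_at Q)"
      by (rule linked_closed_up[OF rot_bars(1)[OF QP(1)] linked_bars[OF QP(1) s]])
    define \<mu> where "\<mu> = tan_half_at Q 0 1 / t 0 1"
    have ratio: "tan_half_at Q i k = \<mu> * t i k" if "i \<noteq> k" for i k
      unfolding \<mu>_def using sgn_tan[OF QP] that
      by (intro closed_up_proportional[OF closed cQ]) (simp_all add: mult.commute)
    have "0 < tan_half_at Q 0 1 * t 0 1" by (rule sgn_tan[OF QP]) simp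
    then have \<mu>: "0 < \<mu>" by (simp add: \<mu>_def zero_less_mult_iff zero_less_divide_iff)
    have tm: "time Q = (\<mu> - 1) / (\<mu> + 1)" by (simp add: time_def \<mu>_def)
    show "time Q \<in> {-1<..<1}" unfolding tm using \<mu> by (simp add: field_simps)
    have "(1 + time Q) / (1 - time Q) = \<mu>" unfolding tm using \<mu> by (simp add: field_simps)
    then have "move (time Q) = placed q0 (\<lambda>i k. \<mu> * t i k)" by (simp only: move_def)
    also have "\<dots> = placed (bar_g Q 0) (tan_half_at Q)"
      unfolding Q0 by (rule placed_cong) (simp add: ratio)
    also have "\<dots> = Q" by (rule placed_bars[OF QP(1) s])
    finally show "move (time Q) = Q" .
  qed
  have P_rel: "P \<in> U \<inter> relative_poses J P" using P PU by (simp add: relative_poses_def)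
  have "time P = 0" using t01 by (simp add: time_def t_def)
  then have "move 0 = P" using move_time[OF P_rel] by simp
  moreover have "homeomorphism {-1<..<1} (U \<inter> relative_poses J P) move time"
  proof (rule homeomorphismI)
    show "continuous_on {-1<..<1} move"
      unfolding move_def by (intro continuous_on_placed continuous_intros) auto
    have "continuous_on (U \<inter> relative_poses J P) (\<lambda>Q. tan_half_at Q 0 1)"
      unfolding tan_half_at_def
    proof (intro continuous_on_divide continuous_on_add continuous_on_const continuous_on_sin_at
        continuous_on_rel ballI)
      fix Q assume Q: "Q \<in> U \<inter> relative_poses J P"
      then have "0 < sin_at Q 0 1 * sin_at P 0 1" by (simp add: U_def)
      then have "sin_at Q 0 1 \<noteq> 0" by auto
      then show "1 + rel Q 0 1 $ 3 $ 3 \<noteq> 0"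
        using cos_at_pos[of Q 0 1] Q by (auto simp: relative_poses_def)
    qed
    moreover have "tan_half_at Q 0 1 / t 0 1 + 1 \<noteq> 0" if "Q \<in> U \<inter> relative_poses J P" for Q
    proof -
      have "0 < tan_half_at Q 0 1 * t 0 1" using that by (intro sgn_tan) (auto simp: relative_poses_def)
      then have "0 < tan_half_at Q 0 1 / t 0 1" by (simp add: zero_less_mult_iff zero_less_divide_iff)
      then show ?thesis by simp
    qed
    ultimately show "continuous_on (U \<inter> relative_poses J P) time"
      unfolding time_def using t01 by (intro continuous_intros) auto
  qed (use move_in time_move move_time time_in in auto)
  ultimately show ?thesis
    unfolding flexible_with_one_dof_def using \<open>open U\<close> PU by blast
qed

end

section \<open>The theorem\<close>

text \<open>The orientations prescribed by halfturns from \<open>\<gamma> 0\<close> and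
  \<open>\<eta> 1\<close> differ from the coherent ones by one sign for all \<open>g\<close> and one
  for all \<open>h\<close>.\<close>

lemma halfturn_linkage_scale:
  assumes "halfturn_linkage a b S" and s: "\<bar>s\<bar> = 1" "\<bar>s'\<bar> = 1"
  shows "halfturn_linkage (\<lambda>i. s *\<^sub>R a i) (\<lambda>i. s' *\<^sub>R b i) S"
proof -
  interpret halfturn_linkage a b S by fact
  have h: "halfturn c (k *\<^sub>R x) = k *\<^sub>R halfturn c x" for c k x
    by (simp add: halfturn_def algebra_simps)
  have "s \<noteq> 0" "s' \<noteq> 0" using s by auto
  then show ?thesis
    by unfold_locales
      (simp_all only: h halfturn_a halfturn_b scaleR_minus_right norm_scaleR s norm_a norm_b mult_1
        norm_S inj_a inj_b scaleR_cancel_left not_False_eq_True simp_thms)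
qed

lemma unit_inner_sq_eq_1:
  fixes x y :: "real^3"
  assumes "norm x = 1" "norm y = 1"
  shows "(x \<bullet> y)\<^sup>2 = 1 \<longleftrightarrow> cross3 x y = 0"
  using norm_cross_dot[of x y] assms by auto

lemma sdist_nondegenerate:
  assumes "norm x = 1" "norm y = 1" "sdist x y \<in> {0<..<pi}"
  shows "(x \<bullet> y)\<^sup>2 \<noteq> 1"
proof
  assume "(x \<bullet> y)\<^sup>2 = 1"
  then have "x \<bullet> y = 1 \<or> x \<bullet> y = - 1" by (simp add: power2_eq_1_iff)
  then show False using assms(3) by (auto simp: sdist_def)
qed

lemma sdist_eqD:
  assumes "norm x = 1" "norm y = 1" "norm x' = 1" "norm y' = 1" "sdist x y = sdist x' y'"
  shows "x \<bullet> y = x' \<bullet> y'"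
proof -
  have "\<bar>x \<bullet> y\<bar> \<le> 1" "\<bar>x' \<bullet> y'\<bar> \<le> 1"
    using Cauchy_Schwarz_ineq2[of x y] Cauchy_Schwarz_ineq2[of x' y'] assms by simp_all
  then show ?thesis using assms(5) by (simp add: sdist_def arccos_eq_iff)
qed

theorem theorem1:
  fixes G H g h :: "4 \<Rightarrow> (real^3) set"
    and J R :: "4 \<Rightarrow> 4 \<Rightarrow> real^3"
    and u v :: "real^3^3^4"
  assumes linkage: "bennett_linkage G H J"
    and directed: "coherently_directed G H J"
    and pose: "(u, v) \<in> poses J"
    and g: "\<And>i. g i = (\<lambda>x. u $ i *v x) ` G i"
    and h: "\<And>j. h j = (\<lambda>x. v $ j *v x) ` H j"
    and R: "\<And>i j. R i j = u $ i *v J i j"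
    and non_aligned: "non_aligned g h"
  shows "flexible_with_one_dof J (u, v) \<and>
    (\<forall>S. symmetry_centers R S \<longrightarrow>
      (\<exists>n. is_great_circle n \<and> (\<forall>m\<in>{1..6}. S m \<in> n) \<and>
        (\<forall>N. spherical_center N n \<longrightarrow>
          (\<forall>\<gamma> \<eta>. standard_orientation g h S \<gamma> \<eta> \<longrightarrow>
            (\<forall>i\<in>{1, 2, 3}.
              (\<exists>!\<rho>. rotation_about N \<rho> \<and> \<rho> (\<gamma> 0) = \<gamma> i) \<and>
              (\<forall>\<rho>. rotation_about N \<rho> \<and> \<rho> (\<gamma> 0) = \<gamma> i \<longrightarrow> \<rho> (\<eta> i) = \<eta> 0))) \<and>
          (\<exists>c1 c2. norm c1 = 1 \<and> norm c2 = 1 \<and> c1 \<bullet> c2 = 0 \<and>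
            N \<in> great_circle c1 \<inter> great_circle c2 \<and>
            (\<forall>i. card (n \<inter> g i) = 2 \<and> card (n \<inter> h i) = 2 \<and>
              (\<forall>c\<in>{c1, c2}.
                gc_reflection c ` (n \<inter> g i) = n \<inter> h i \<and>
                gc_reflection c ` (n \<inter> h i) = n \<inter> g i))))))"
proof -
  obtain a b where unit: "\<And>i. norm (a i) = 1" "\<And>k. norm (b k) = 1"
    and GH: "\<And>i. G i = great_circle (a i)" "\<And>k. H k = great_circle (b k)"
    and dir: "\<And>i j k l. {i, j, k, l} = {0, 1, 2, 3} \<Longrightarrow> a i \<bullet> cross3 (J i k) (J i l) = a j \<bullet> cross3 (J j k) (J j l)"
      "\<And>i j k l. {i, j, k, l} = {0, 1, 2, 3} \<Longrightarrow> b l \<bullet> cross3 (J i l) (J j l) = b k \<bullet> cross3 (J i k) (J j k)"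
    using directed unfolding coherently_directed_def by metis
  have J: "J i k \<in> great_circle (a i)" "J i k \<in> great_circle (b k)" if "i \<noteq> k" for i k
    using linkage that GH unfolding bennett_linkage_def by auto
  have iso: "spherical_isogram (J i k) (J i l) (J j l) (J j k)" if "{i, j, k, l} = {0, 1, 2, 3}" for i j k l
    using linkage that unfolding bennett_linkage_def by blast
  have len: "J i k \<bullet> J i l = J j k \<bullet> J j l" "J i l \<bullet> J j l = J i k \<bullet> J j k"
    and nondeg: "(J i k \<bullet> J i l)\<^sup>2 \<noteq> 1" "(J i k \<bullet> J j k)\<^sup>2 \<noteq> 1"
    if "{i, j, k, l} = {0, 1, 2, 3}" for i j k l
    using iso[OF that] sdist_eqD sdist_nondegenerate unfolding spherical_isogram_def
    by (metis inner_commute)+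
  obtain T S \<alpha> \<beta> where al: "aligned_linkage T S" and rot: "\<And>i. rotation_matrix (\<alpha> i)" "\<And>k. rotation_matrix (\<beta> k)"
    and poles: "\<And>i. \<alpha> i *v a i = pole" "\<And>k. \<beta> k *v b k = pole"
    and eqJ: "\<And>i k. i \<noteq> k \<Longrightarrow> \<alpha> i *v J i k = equator (T i * S k)" "\<And>i k. i \<noteq> k \<Longrightarrow> \<beta> k *v J i k = equator (T i * S k)"
    by (rule aligned_frame[of a b J])
      (rule unit | erule J | erule len | erule dir | erule nondeg | blast intro: that)+
  interpret aligned_bars T S \<alpha> \<beta> J
    by (intro aligned_bars.intro al) (unfold_locales; fact)
  have ru: "rotation_matrix (u $ i)" and rv: "rotation_matrix (v $ i)" for i
    using pose by (auto simp: poses_def)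
  have Rv: "R i k = v $ k *v J i k" if "i \<noteq> k" for i k
    using pose that by (auto simp: poses_def R)
  \<comment> \<open>The poles of the coherently directed bars in the given pose.\<close>
  define A B where "A i = u $ i *v a i" and "B k = v $ k *v b k" for i k
  have nA: "norm (A i) = 1" and nB: "norm (B i) = 1" for i
    using rotation_matrix_norm[OF ru] rotation_matrix_norm[OF rv] unit by (simp_all add: A_def B_def)
  have gA: "g i = great_circle (A i)" and hB: "h i = great_circle (B i)" for i
    using rotation_matrix_great_circle[OF ru] rotation_matrix_great_circle[OF rv]
    by (simp_all add: g h GH A_def B_def)
  have AB: "cross3 (A i) (B k) \<noteq> 0" if "i \<noteq> k" for i k
    using non_aligned that unfolding non_aligned_def gA hB great_circle_eq_iff[OF nA nB] unit_cross3_eq_0[OF nA nB]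
    by blast
  have RA: "A i \<bullet> R i k = 0" and RB: "B k \<bullet> R i k = 0" and nR: "norm (R i k) = 1" if ik: "i \<noteq> k" for i k
    using J[OF ik] rotation_matrix_inner[OF ru, of i "a i" "J i k"] rotation_matrix_inner[OF rv, of k "b k" "J i k"]
      rotation_matrix_norm[OF ru, of i "J i k"]
    by (simp_all add: great_circle_def A_def B_def Rv[OF ik, symmetric] R[symmetric])
  have cu: "cross3 (R i k) (R i l) = u $ i *v cross3 (J i k) (J i l)" for i k l
    unfolding R by (rule cross_rotation_matrix[OF ru])
  have cv: "cross3 (R i k) (R j k) = v $ k *v cross3 (J i k) (J j k)" if "i \<noteq> k" "j \<noteq> k" for i j k
    unfolding Rv[OF that(1)] Rv[OF that(2)] by (rule cross_rotation_matrix[OF rv])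
  have iu: "R i k \<bullet> R i l = J i k \<bullet> J i l" for i k l
    unfolding R by (rule rotation_matrix_inner[OF ru])
  have iv: "R i k \<bullet> R j k = J i k \<bullet> J j k" if "i \<noteq> k" "j \<noteq> k" for i j k
    unfolding Rv[OF that(1)] Rv[OF that(2)] by (rule rotation_matrix_inner[OF rv])
  \<comment> \<open>If the sine vanishes, the relative cosine, which is
    \<open>A i \<bullet> B k\<close>, is 1 or -1, and the circles \<open>g i\<close> and
    \<open>h k\<close> coincide.\<close>
  have "sin_at (u, v) i k \<noteq> 0" if ik: "i \<noteq> k" for i k
  proof
    assume "sin_at (u, v) i k = 0"
    then have 1: "(rel (u, v) i k $ 3 $ 3)\<^sup>2 = 1"
      using sin_cos_at[OF pose ik] by simp
    have p: "transpose (\<alpha> i) *v pole = a i" "transpose (\<beta> k) *v pole = b k"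
      using poles rot_inverse(2)[OF rot(1)] rot_inverse(2)[OF rot(2)]
      by (metis matrix_vector_mul_assoc matrix_vector_mul_lid)+
    have "bar_g (u, v) i *v pole = A i" "bar_h (u, v) k *v pole = B k"
      unfolding bar_g_def bar_h_def A_def B_def matrix_vector_mul_assoc[symmetric] p by simp_all
    moreover have "bar_g (u, v) i *v (rel (u, v) i k *v pole) = bar_h (u, v) k *v pole"
      using rot_inverse(1)[OF rot_bars(1)[OF pose, of i]]
      by (simp add: rel_def matrix_vector_mul_assoc matrix_mul_assoc)
    ultimately have "A i \<bullet> B k = pole \<bullet> (rel (u, v) i k *v pole)"
      using rotation_matrix_inner[OF rot_bars(1)[OF pose, of i], of pole "rel (u, v) i k *v pole"] by simp
    also have "\<dots> = rel (u, v) i k $ 3 $ 3"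
      by (simp add: inner_vec_def sum_3 matrix_vector_pole)
    finally have "(A i \<bullet> B k)\<^sup>2 = 1" using 1 by simp
    then show False using unit_inner_sq_eq_1[OF nA nB] AB[OF ik] by blast
  qed
  then have flex: "flexible_with_one_dof J (u, v)" by (rule flexible[OF pose])
  \<comment> \<open>Rotations preserve lengths and directed arcs, so \<open>isogram_halfturn\<close>
    applies in the pose. It yields the image of \<open>B l\<close>, from which that of
    \<open>B k\<close> follows because a halfturn is an involution.\<close>
  have half: "norm s = 1" "halfturn s (A i) = - A j" "halfturn s (B k) = - B l"
    if ijkl: "{i, j, k, l} = {0, 1, 2, 3}" and s: "symmetry_center (R i k) (R i l) (R j l) (R j k) s" for i j k l s
  proof -
    have d: "i \<noteq> j" "i \<noteq> k" "i \<noteq> l" "j \<noteq> k" "j \<noteq> l" "k \<noteq> l"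
      using distinct_of_set_4[OF ijkl] by auto
    have 1: "R i k \<bullet> R i l = R j l \<bullet> R j k" "R i l \<bullet> R j l = R j k \<bullet> R i k"
      using len[OF ijkl] d by (simp_all add: iu iv inner_commute)
    have 2: "A i \<bullet> cross3 (R i k) (R i l) = A j \<bullet> cross3 (R j k) (R j l)"
      unfolding cu A_def rotation_matrix_inner[OF ru] by (rule dir(1)[OF ijkl])
    have 3: "B l \<bullet> cross3 (R i l) (R j l) = B k \<bullet> cross3 (R i k) (R j k)"
      unfolding cv[OF d(3) d(5)] cv[OF d(2) d(4)] B_def rotation_matrix_inner[OF rv] by (rule dir(2)[OF ijkl])
    have "{i, j, l, k} = {0, 1, 2, 3}" using ijkl by (simp add: insert_commute)
    then have 4: "cross3 (R i k) (R i l) \<noteq> 0" "cross3 (R i l) (R j l) \<noteq> 0"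
      using nondeg(1)[OF ijkl] nondeg(2)[of i j l k] d
      by (simp_all add: unit_inner_sq_eq_1[symmetric] nR iu iv)
    note i = isogram_halfturn[OF nR[OF d(2)] nR[OF d(3)] nR[OF d(5)] nR[OF d(4)] nA[of i] nA[of j] nB[of l] nB[of k]
        RA[OF d(2)] RA[OF d(3)] RA[OF d(5)] RA[OF d(4)] RB[OF d(3)] RB[OF d(5)] RB[OF d(2)] RB[OF d(4)]
        1 2 3 4 AB[OF d(3)] AB[OF d(2)] s]
    show "norm s = 1" "halfturn s (A i) = - A j" by (fact i)+
    show "halfturn s (B k) = - B l" by (rule halfturn_uminus_swap[OF i(1,3)])
  qed
  \<comment> \<open>If \<open>A i = A j\<close>, then for a third index \<open>k\<close> the joints
    \<open>R i k\<close> and \<open>R j k\<close> would both lie on the two different circles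
    \<open>g i\<close> and \<open>h k\<close>, although they bound a side. The poles
    \<open>B i\<close> and \<open>B j\<close> are treated in the same way.\<close>
  have inj: "A i \<noteq> A j" "B i \<noteq> B j" if ij: "i \<noteq> j" for i j
  proof -
    define k :: 4 where "k = (if 0 \<noteq> i \<and> 0 \<noteq> j then 0 else if 1 \<noteq> i \<and> 1 \<noteq> j then 1 else 2)"
    have k: "i \<noteq> k" "j \<noteq> k" using ij by (auto simp: k_def split: if_splits)
    obtain l where "{i, l, j, k} = {0, 1, 2, 3}" by (rule ex_fourth_index[OF ij k])
    then have l: "{i, j, k, l} = {0, 1, 2, 3}" "{k, l, i, j} = {0, 1, 2, 3}" by (simp_all add: insert_commute)
    have "cross3 (R i k) (R j k) \<noteq> 0" "cross3 (R k i) (R k j) \<noteq> 0"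
      using nondeg(2)[OF l(1)] nondeg(1)[OF l(2)] k k[symmetric]
      by (simp_all add: unit_inner_sq_eq_1[symmetric] nR iu iv)
    then show "A i \<noteq> A j" "B i \<noteq> B j"
      using cross3_self_eq_0_of_orthogonal[OF AB[OF k(1)], of "R i k" "R j k"] RA[OF k(1)] RA[OF k(2)] RB[OF k(1)] RB[OF k(2)]
        cross3_self_eq_0_of_orthogonal[OF AB[OF k(1)[symmetric]], of "R k i" "R k j"]
        RA[OF k(1)[symmetric]] RA[OF k(2)[symmetric]] RB[OF k(1)[symmetric]] RB[OF k(2)[symmetric]]
      by auto
  qed
  show ?thesis
  proof (intro conjI allI impI)
    show "flexible_with_one_dof J (u, v)" by (fact flex)
  next
    fix S assume "symmetry_centers R S"
    then have c: "symmetry_center (R 0 1) (R 0 2) (R 3 2) (R 3 1) (S 1)"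
      "symmetry_center (R 0 2) (R 0 3) (R 1 3) (R 1 2) (S 2)"
      "symmetry_center (R 0 1) (R 0 3) (R 2 3) (R 2 1) (S 3)"
      "symmetry_center (R 1 3) (R 1 0) (R 2 0) (R 2 3) (S 4)"
      "symmetry_center (R 2 1) (R 2 0) (R 3 0) (R 3 1) (S 5)"
      "symmetry_center (R 1 2) (R 1 0) (R 3 0) (R 3 2) (S 6)"
      unfolding symmetry_centers_def by blast+
    have idx: "{0, 3, 1, 2} = {0, 1, 2, 3::4}" "{0, 1, 2, 3} = {0, 1, 2, 3::4}" "{0, 2, 1, 3} = {0, 1, 2, 3::4}"
      "{1, 2, 3, 0} = {0, 1, 2, 3::4}" "{2, 3, 1, 0} = {0, 1, 2, 3::4}" "{1, 3, 2, 0} = {0, 1, 2, 3::4}"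
      by auto
    note s = half[OF idx(1) c(1)] half[OF idx(2) c(2)] half[OF idx(3) c(3)]
      half[OF idx(4) c(4)] half[OF idx(5) c(5)] half[OF idx(6) c(6)]
    have "{1..6} = {1, 2, 3, 4, 5, 6::nat}" by auto
    then have nS: "norm (S m) = 1" if "m \<in> {1..6}" for m
      using that s(1,4,7,10,13,16) by (metis empty_iff insert_iff)
    have link: "halfturn_linkage A B S"
      by (rule halfturn_linkage.intro) (fact nA nB nS inj s)+
    then interpret halfturn_linkage A B S .
    obtain N0 where N0: "norm N0 = 1" "\<forall>m\<in>{1..6}. N0 \<bullet> S m = 0"
      using centers_coplanar by blast
    show "\<exists>n. is_great_circle n \<and> (\<forall>m\<in>{1..6}. S m \<in> n) \<and>
        (\<forall>N. spherical_center N n \<longrightarrow>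
          (\<forall>\<gamma> \<eta>. standard_orientation g h S \<gamma> \<eta> \<longrightarrow>
            (\<forall>i\<in>{1, 2, 3}.
              (\<exists>!\<rho>. rotation_about N \<rho> \<and> \<rho> (\<gamma> 0) = \<gamma> i) \<and>
              (\<forall>\<rho>. rotation_about N \<rho> \<and> \<rho> (\<gamma> 0) = \<gamma> i \<longrightarrow> \<rho> (\<eta> i) = \<eta> 0))) \<and>
          (\<exists>c1 c2. norm c1 = 1 \<and> norm c2 = 1 \<and> c1 \<bullet> c2 = 0 \<and>
            N \<in> great_circle c1 \<inter> great_circle c2 \<and>
            (\<forall>i. card (n \<inter> g i) = 2 \<and> card (n \<inter> h i) = 2 \<and>
              (\<forall>c\<in>{c1, c2}.
                gc_reflection c ` (n \<inter> g i) = n \<inter> h i \<and>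
                gc_reflection c ` (n \<inter> h i) = n \<inter> g i))))"
    proof (intro exI[of _ "great_circle N0"] conjI allI impI)
      show "is_great_circle (great_circle N0)" using N0 unfolding is_great_circle_def by blast
      show Sn: "\<forall>m\<in>{1..6}. S m \<in> great_circle N0" using N0 nS by (simp add: great_circle_def)
      fix N assume "spherical_center N (great_circle N0)"
      then have N: "norm N = 1" "great_circle N0 = great_circle N"
        by (simp_all add: spherical_center_def)
      have NS: "N \<bullet> S m = 0" if "m \<in> {1..6}" for m
      proof -
        have "S m \<in> great_circle N" using Sn that N(2) by blast
        then show ?thesis by (simp add: great_circle_def)
      qed
      \<comment> \<open>The center \<open>S 1\<close> serves as the real direction, being a unit
        vector orthogonal to every spherical center of \<open>n\<close>.\<close>
      have planar: "planar_halfturn_linkage A' B' S N (S 1)" if "halfturn_linkage A' B' S" for A' B'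
      proof -
        have "planar_frame N (S 1)" by unfold_locales (use N NS nS in auto)
        then show ?thesis
          using that NS by (simp add: planar_halfturn_linkage_def planar_halfturn_linkage_axioms_def)
      qed
      show "\<exists>c1 c2. norm c1 = 1 \<and> norm c2 = 1 \<and> c1 \<bullet> c2 = 0 \<and>
            N \<in> great_circle c1 \<inter> great_circle c2 \<and>
            (\<forall>i. card (great_circle N0 \<inter> g i) = 2 \<and> card (great_circle N0 \<inter> h i) = 2 \<and>
              (\<forall>c\<in>{c1, c2}.
                gc_reflection c ` (great_circle N0 \<inter> g i) = great_circle N0 \<inter> h i \<and>
                gc_reflection c ` (great_circle N0 \<inter> h i) = great_circle N0 \<inter> g i))"
        unfolding N(2) gA hB
        using planar_halfturn_linkage.orthogonal_mirrors[OF planar[OF link]]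
          planar_halfturn_linkage.card_Int[OF planar[OF link]]
        by simp
      fix \<gamma> \<eta> assume std: "standard_orientation g h S \<gamma> \<eta>"
      then have "norm (\<gamma> 0) = 1" "great_circle (\<gamma> 0) = great_circle (A 0)"
          "norm (\<eta> 1) = 1" "great_circle (\<eta> 1) = great_circle (B 1)"
        by (simp_all add: standard_orientation_def gA hB flip: gA hB)
      then have "\<exists>s. \<bar>s\<bar> = 1 \<and> \<gamma> 0 = s *\<^sub>R A 0" "\<exists>s. \<bar>s\<bar> = 1 \<and> \<eta> 1 = s *\<^sub>R B 1"
        using great_circle_eq_iff nA nB by (metis abs_1 abs_minus_cancel scaleR_minus1_left scaleR_one)+
      then obtain s s' where ss: "\<bar>s\<bar> = 1" "\<bar>s'\<bar> = 1" "\<gamma> 0 = s *\<^sub>R A 0" "\<eta> 1 = s' *\<^sub>R B 1" by blast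
      have ht: "halfturn x (k *\<^sub>R y) = k *\<^sub>R halfturn x y" for x k y
        by (simp add: halfturn_def algebra_simps)
      have o: "- \<gamma> 3 = halfturn (S 1) (\<gamma> 0)" "- \<gamma> 1 = halfturn (S 2) (\<gamma> 0)" "- \<gamma> 2 = halfturn (S 3) (\<gamma> 0)"
        "- \<eta> 2 = halfturn (S 1) (\<eta> 1)" "- \<eta> 3 = halfturn (S 3) (\<eta> 1)" "- \<eta> 0 = halfturn (S 5) (\<eta> 1)"
        using std unfolding standard_orientation_def by blast+
      \<comment> \<open>The prescribed orientations are propagated by the same halfturns as the
        poles \<open>A i\<close> and \<open>B i\<close>, so the sign of the initial circle is
        inherited by its whole family.\<close>
      have "\<forall>i. \<gamma> i = s *\<^sub>R A i" "\<forall>i. \<eta> i = s' *\<^sub>R B i"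
        using o ss(3,4) unfolding all_4_iff ss(3,4) ht halfturn_a halfturn_b by simp_all
      then have "halfturn_linkage \<gamma> \<eta> S"
        using halfturn_linkage_scale[OF link ss(1,2)] by (simp flip: fun_eq_iff)
      from planar_halfturn_linkage.rotation_swap[OF planar[OF this]]
      show "\<forall>i\<in>{1, 2, 3}. (\<exists>!\<rho>. rotation_about N \<rho> \<and> \<rho> (\<gamma> 0) = \<gamma> i) \<and>
              (\<forall>\<rho>. rotation_about N \<rho> \<and> \<rho> (\<gamma> 0) = \<gamma> i \<longrightarrow> \<rho> (\<eta> i) = \<eta> 0)"
        by blast
    qed
  qed
qed

end
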